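(* Consider longitudinal data $Z = (X_1, A_1, \dots, X_T, A_T, Y)$ generated by the nonparametric structural equation model and counterfactuals described in the context, and suppose strong sequential randomization holds: $U_{A,t} \perp \{\underline U_{X,t+1}, \underline U_{A,t+1}, U_Y\} \mid H_t$ for all $t \le T$. Fix a target regime $\overline a_T = (a_1,\dots,a_T) \in \{0,1\}^T$ and weight functions $f_t$ mapping histories $h_t$ to $[0,1]$, $t=1,\dots,T$, and let $\overline D_{\overline f}(\overline a_T)$ be the sequence of longitudinal flip interventions targeting $\overline a_T$ (defined in the context). Suppose that, for every $t$, either (1) $\mathbb{P}\{\mathbb{P}(A_t = a_t \mid H_t) = 0 \implies f_t(H_t) = 0\} = 1$, or (2) $\mathbb{P}\{\mathbb{P}(A_t = a_t \mid H_t) = 0\} = 0$. Define $Q_t(a_t \mid h_t) = \mathbb{P}(A_t = a_t \mid h_t) + f_t(h_t)\{1 - \mathbb{P}(A_t = a_t \mid h_t)\}$ and $Q_t(1-a_t \mid h_t) = 1 - Q_t(a_t \mid h_t)$. Then \[ \mathbb{E}\big[Y\{\overline D_{\overline f}(\overline a_T)\}\big] = \sum_{\overline b_T \in \{0,1\}^T} \int \mathbb{E}(Y \mid \overline A_T = \overline b_T, \overline X_T = \overline x_T) \prod_{t=1}^T Q_t(b_t \mid \overline b_{t-1}, \overline x_t)\, d\mathbb{P}(x_t \mid \overline b_{t-1}, \overline x_{t-1}) = \mathbb{E}\Big[ Y \prod_{t=1}^T \frac{Q_t(A_t \mid H_t)}{\mathbb{P}(A_t \mid H_t)}\Big], \]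 and, for each $t \le T$, \[ \mathbb{E}\{D_{f_t}(a_t)\} = \sum_{\overline b_{t-1} \in \{0,1\}^{t-1}} \int Q_t(1 \mid \overline b_{t-1}, \overline x_t)\, d\mathbb{P}(x_t \mid \overline b_{t-1}, \overline x_{t-1}) \prod_{s=1}^{t-1} Q_s(b_s \mid \overline b_{s-1}, \overline x_s)\, d\mathbb{P}(x_s \mid \overline b_{s-1}, \overline x_{s-1}) = \mathbb{E}\Big[ Q_t(1 \mid H_t) \prod_{s=1}^{t-1} \frac{Q_s(A_s \mid H_s)}{\mathbb{P}(A_s \mid H_s)}\Big], \] where $D_{f_t}(a_t)$ is the time-$t$ component of $\overline D_{\overline f}(\overline a_T)$.
   Context: Data: $X_t \in \mathbb{R}^d$ time-varying covariates, $A_t \in \{0,1\}$ binary treatments, $Y\in\mathbb{R}$ final outcome. For a time-varying variable $O_t$, $\overline O_t = (O_1,\dots,O_t)$ and $\underline O_t = (O_t,\dots,O_T)$. $H_t = (\overline X_t, \overline A_{t-1})$ is the history before treatment at time $t$; $\mathbb{P}(A_t \mid H_t)$ denotes $\mathbb{P}(A_t = b \mid H_t)$ evaluated at $b = A_t$, and similarly $Q_t(A_t\mid H_t)$. Structural model: there are deterministic functions with $X_t = f_{X,t}(A_{t-1}, H_{t-1}, U_{X,t})$, $A_t = f_{A,t}(H_t, U_{A,t})$, $Y = f_Y(A_T, H_T, U_Y)$, for exogenous variables $U_{X,t}, U_{A,t}, U_Y$. An intervention replaces the equation for $A_t$ by an assigned value $D_t$. Under interventions $\overline D_{t-1}$ up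 to time $t-1$, counterfactuals are $X_t(\overline D_{t-1}) = f_{X,t}\{D_{t-1}, H_{t-1}(\overline D_{t-2}), U_{X,t}\}$, $A_t(\overline D_{t-1}) = f_{A,t}\{H_t(\overline D_{t-1}), U_{A,t}\}$ (the natural value of treatment), with $H_t(\overline D_{t-1}) = \{\overline D_{t-1}, \overline X_t(\overline D_{t-1})\}$, $A_1(D_0)=A_1$, $X_1(D_0)=X_1$; and $Y(\overline D_T) = f_Y\{D_T, H_T(\overline D_{T-1}), U_Y\}$. Consistency is implicit in this model. Flip interventions: let $V_1,\dots,V_T$ be iid $\mathrm{Unif}(0,1)$, independent of all other variables in the model. Recursively, with $\overline D_{t-1} = (D_{f_1}(a_1),\dots,D_{f_{t-1}}(a_{t-1}))$, set $D_{f_t}(a_t) = A_t(\overline D_{t-1})$ if $A_t(\overline D_{t-1}) = a_t$, and otherwise $D_{f_t}(a_t) = a_t \mathbf{1}[V_t \le f_t\{H_t(\overline D_{t-1})\}] + A_t(\overline D_{t-1})\mathbf{1}[V_t > f_t\{H_t(\overline D_{t-1})\}]$. That is, a subject whose natural treatment equals the target is left alone, and otherwise is flipped to the target with probability $f_t$ of its counterfactual history. $\overline D_{\overline f}(\overline a_T) = (D_{f_1}(a_1), \dots, D_{f_T}(a_T))$. *)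

theory Defs
  imports "HOL-Probability.Probability"
begin

text \<open>Histories. A history is a pair (xs, as) of a covariate path and a treatment path;
  the history H_t = (X_1..X_t, A_1..A_{t-1}) is represented with xs extensional on {1..t}
  and as extensional on {1..<t}.\<close>

type_synonym 'x hist = "(nat \<Rightarrow> 'x) \<times> (nat \<Rightarrow> bool)"

definition HistM :: "nat \<Rightarrow> ('x::topological_space) hist measure" where
  "HistM t = PiM {1..t} (\<lambda>_. borel) \<Otimes>\<^sub>M PiM {1..<t} (\<lambda>_. count_space UNIV)"

definition PrevM :: "nat \<Rightarrow> ('x::topological_space) hist measure" where
  "PrevM t = PiM {1..<t} (\<lambda>_. borel) \<Otimes>\<^sub>M PiM {1..<t} (\<lambda>_. count_space UNIV)"

text \<open>Nonparametric structural equation model: structural functions, exogenous variables,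
  and the auxiliary uniforms V_t used by flip interventions.\<close>
record ('w, 'x, 'ux, 'ua, 'uy) scm =
  fX :: "nat \<Rightarrow> 'x hist \<Rightarrow> 'ux \<Rightarrow> 'x"   \<comment> \<open>X_t = fX t (xbar_{t-1}, abar_{t-1}) U_{X,t}\<close>
  fA :: "nat \<Rightarrow> 'x hist \<Rightarrow> 'ua \<Rightarrow> bool" \<comment> \<open>A_t = fA t H_t U_{A,t}\<close>
  fY :: "'x hist \<Rightarrow> 'uy \<Rightarrow> real"          \<comment> \<open>Y = fY (xbar_T, abar_T) U_Y\<close>
  UX :: "nat \<Rightarrow> 'w \<Rightarrow> 'ux"
  UA :: "nat \<Rightarrow> 'w \<Rightarrow> 'ua"
  UY :: "'w \<Rightarrow> 'uy"
  V  :: "nat \<Rightarrow> 'w \<Rightarrow> real"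

text \<open>A (dynamic, possibly randomized) intervention rule: at time t it maps the counterfactual
  history, the natural value of treatment and V_t to the assigned treatment D_t.\<close>
type_synonym 'x regime = "nat \<Rightarrow> 'x hist \<Rightarrow> bool \<Rightarrow> real \<Rightarrow> bool"

primrec cfH :: "('w, 'x, 'ux, 'ua, 'uy, 'z) scm_scheme \<Rightarrow> 'x regime \<Rightarrow> nat \<Rightarrow> 'w \<Rightarrow> 'x hist" where
  "cfH S g 0 \<omega> = (\<lambda>_. undefined, \<lambda>_. undefined)"
| "cfH S g (Suc t) \<omega> =
     (let (xs, ds) = cfH S g t \<omega>;
          ds' = (if t = 0 then ds
                 else ds(t := g t (xs, ds) (fA S t (xs, ds) (UA S t \<omega>)) (V S t \<omega>)))
      in (xs(Suc t := fX S (Suc t) (xs, ds') (UX S (Suc t) \<omega>)), ds'))"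

definition cfNatA :: "('w, 'x, 'ux, 'ua, 'uy, 'z) scm_scheme \<Rightarrow> 'x regime \<Rightarrow> nat \<Rightarrow> 'w \<Rightarrow> bool" where
  "cfNatA S g t \<omega> = fA S t (cfH S g t \<omega>) (UA S t \<omega>)"

definition cfD :: "('w, 'x, 'ux, 'ua, 'uy, 'z) scm_scheme \<Rightarrow> 'x regime \<Rightarrow> nat \<Rightarrow> 'w \<Rightarrow> bool" where
  "cfD S g t \<omega> = g t (cfH S g t \<omega>) (cfNatA S g t \<omega>) (V S t \<omega>)"

definition cfY :: "('w, 'x, 'ux, 'ua, 'uy, 'z) scm_scheme \<Rightarrow> nat \<Rightarrow> 'x regime \<Rightarrow> 'w \<Rightarrow> real" where
  "cfY S T g \<omega> = fY S (fst (cfH S g T \<omega>), (snd (cfH S g T \<omega>))(T := cfD S g T \<omega>)) (UY S \<omega>)"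

definition natural_regime :: "'x regime" where
  "natural_regime t h n v = n"

definition flip_regime :: "(nat \<Rightarrow> bool) \<Rightarrow> (nat \<Rightarrow> 'x hist \<Rightarrow> real) \<Rightarrow> 'x regime" where
  "flip_regime a f t h n v = (if n = a t then n else if v \<le> f t h then a t else n)"

text \<open>Observed data (consistency is built into the model).\<close>
definition obsX :: "('w, 'x, 'ux, 'ua, 'uy, 'z) scm_scheme \<Rightarrow> nat \<Rightarrow> 'w \<Rightarrow> 'x" where
  "obsX S t \<omega> = fst (cfH S natural_regime t \<omega>) t"

definition obsA :: "('w, 'x, 'ux, 'ua, 'uy, 'z) scm_scheme \<Rightarrow> nat \<Rightarrow> 'w \<Rightarrow> bool" where
  "obsA S t \<omega> = cfD S natural_regime t \<omega>"

definition obsY :: "('w, 'x, 'ux, 'ua, 'uy, 'z) scm_scheme \<Rightarrow> nat \<Rightarrow> 'w \<Rightarrow> real" where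
  "obsY S T \<omega> = cfY S T natural_regime \<omega>"

definition obsH :: "('w, 'x, 'ux, 'ua, 'uy, 'z) scm_scheme \<Rightarrow> nat \<Rightarrow> 'w \<Rightarrow> 'x hist" where
  "obsH S t \<omega> = (restrict (\<lambda>s. obsX S s \<omega>) {1..t}, restrict (\<lambda>s. obsA S s \<omega>) {1..<t})"

text \<open>Observed (Xbar_{t-1}, Abar_{t-1}); obsPrev S (Suc T) is (Xbar_T, Abar_T).\<close>
definition obsPrev :: "('w, 'x, 'ux, 'ua, 'uy, 'z) scm_scheme \<Rightarrow> nat \<Rightarrow> 'w \<Rightarrow> 'x hist" where
  "obsPrev S t \<omega> = (restrict (\<lambda>s. obsX S s \<omega>) {1..<t}, restrict (\<lambda>s. obsA S s \<omega>) {1..<t})"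

definition is_regression :: "'w measure \<Rightarrow> ('w \<Rightarrow> 'z) \<Rightarrow> 'z measure \<Rightarrow> ('w \<Rightarrow> real) \<Rightarrow> ('z \<Rightarrow> real) \<Rightarrow> bool" where
  "is_regression M Z MZ W phi \<longleftrightarrow>
     phi \<in> borel_measurable MZ \<and>
     (AE \<omega> in M. phi (Z \<omega>) = real_cond_exp M (vimage_algebra (space M) Z MZ) W \<omega>)"

definition cond_indep :: "'w measure \<Rightarrow> ('w \<Rightarrow> 'z) \<Rightarrow> 'z measure \<Rightarrow> ('w \<Rightarrow> 'a) \<Rightarrow> 'a measure
    \<Rightarrow> ('w \<Rightarrow> 'b) \<Rightarrow> 'b measure \<Rightarrow> bool" where
  "cond_indep M Z MZ X MX W MW \<longleftrightarrow>
     (\<forall>A\<in>sets MX. \<forall>B\<in>sets MW. AE \<omega> in M.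
        real_cond_exp M (vimage_algebra (space M) Z MZ)
           (\<lambda>\<omega>. indicator A (X \<omega>) * indicator B (W \<omega>)) \<omega>
        = real_cond_exp M (vimage_algebra (space M) Z MZ) (\<lambda>\<omega>. indicator A (X \<omega>)) \<omega>
          * real_cond_exp M (vimage_algebra (space M) Z MZ) (\<lambda>\<omega>. indicator B (W \<omega>)) \<omega>)"

text \<open>P(A_t = b | h) from a version pA t of P(A_t = 1 | H_t = h).\<close>
definition pAt :: "(nat \<Rightarrow> 'x hist \<Rightarrow> real) \<Rightarrow> nat \<Rightarrow> bool \<Rightarrow> 'x hist \<Rightarrow> real" where
  "pAt pA t b h = (if b then pA t h else 1 - pA t h)"

definition Qf :: "(nat \<Rightarrow> 'x hist \<Rightarrow> real) \<Rightarrow> (nat \<Rightarrow> 'x hist \<Rightarrow> real) \<Rightarrow> (nat \<Rightarrow> bool)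
    \<Rightarrow> nat \<Rightarrow> bool \<Rightarrow> 'x hist \<Rightarrow> real" where
  "Qf pA f a t b h =
     (let q = pAt pA t (a t) h + f t h * (1 - pAt pA t (a t) h) in if b = a t then q else 1 - q)"

primrec itint :: "(nat \<Rightarrow> (nat \<Rightarrow> 'x) \<Rightarrow> 'x measure) \<Rightarrow> (nat \<Rightarrow> (nat \<Rightarrow> 'x) \<Rightarrow> real)
    \<Rightarrow> ((nat \<Rightarrow> 'x) \<Rightarrow> real) \<Rightarrow> nat \<Rightarrow> nat \<Rightarrow> (nat \<Rightarrow> 'x) \<Rightarrow> real" where
  "itint \<kappa> w g 0 t xs = g xs"
| "itint \<kappa> w g (Suc k) t xs =
     (\<integral>x. w t (xs(t := x)) * itint \<kappa> w g k (Suc t) (xs(t := x)) \<partial>(\<kappa> t xs))"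

definition gformula_Y :: "(nat \<Rightarrow> 'x hist \<Rightarrow> 'x measure) \<Rightarrow> ('x hist \<Rightarrow> real)
    \<Rightarrow> (nat \<Rightarrow> 'x hist \<Rightarrow> real) \<Rightarrow> (nat \<Rightarrow> 'x hist \<Rightarrow> real) \<Rightarrow> (nat \<Rightarrow> bool) \<Rightarrow> nat \<Rightarrow> real" where
  "gformula_Y K mu pA f a T =
     (\<Sum>bs\<in>PiE {1..T} (\<lambda>_. UNIV).
        itint (\<lambda>t xs. K t (xs, restrict bs {1..<t}))
              (\<lambda>t xs. Qf pA f a t (bs t) (xs, restrict bs {1..<t}))
              (\<lambda>xs. mu (xs, bs)) T 1 (\<lambda>_. undefined))"

definition gformula_D :: "(nat \<Rightarrow> 'x hist \<Rightarrow> 'x measure)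
    \<Rightarrow> (nat \<Rightarrow> 'x hist \<Rightarrow> real) \<Rightarrow> (nat \<Rightarrow> 'x hist \<Rightarrow> real) \<Rightarrow> (nat \<Rightarrow> bool) \<Rightarrow> nat \<Rightarrow> real" where
  "gformula_D K pA f a t =
     (\<Sum>bs\<in>PiE {1..<t} (\<lambda>_. UNIV).
        itint (\<lambda>s xs. K s (xs, restrict bs {1..<s}))
              (\<lambda>s xs. if s = t then Qf pA f a t True (xs, bs)
                      else Qf pA f a s (bs s) (xs, restrict bs {1..<s}))
              (\<lambda>_. 1) t 1 (\<lambda>_. undefined))"

end

theory Submission
  imports Defs
begin

text \<open>
  Let \<open>R k\<close> be the product of the ratios \<open>Q / P\<close> along the observed data up to time \<open>k\<close>. Consider the
  expectation, weighted by \<open>R k\<close>, of the outcome obtained by following the observed data up to time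
  \<open>k\<close> and the flip interventions afterwards. It does not depend on \<open>k\<close>: given the history before
  treatment \<open>k\<close>, strong sequential randomization makes that treatment independent of the rest of the
  future, flipping it with a fresh uniform variable turns its law \<open>P\<close> into \<open>Q\<close>, and by the positivity
  condition \<open>Q\<close> vanishes where \<open>P\<close> does, so that reweighting has the same effect. The case \<open>k = 0\<close> is
  the counterfactual mean and \<open>k = T\<close> the weighted mean. Nonnegative outcomes need no integrability, and
  the positive and negative parts give the real case.

  For the g-formula, fix a treatment path and let \<open>I k\<close> be the inner part of the iterated integral from
  time \<open>k + 1\<close> on. The \<open>R k\<close>-weighted expectation of \<open>I k\<close> on the event that the observed treatments
  follow the path up to time \<open>k\<close> does not depend on \<open>k\<close> either, by conditioning first on the history
  and then on the past. The mean of the assigned treatment at time \<open>t\<close> is the case of horizon \<open>t\<close> with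
  the last treatment as outcome.
\<close>

section \<open>Regressions, conditional independence and kernels\<close>

text \<open>Strong sequential randomization speaks of an event of \<open>UA S t\<close> and an event
  of the later exogenous variables. The argument needs more: an event of the pair (history,
  \<open>UA S t\<close>), namely that the treatment takes a given value, and an arbitrary
  nonnegative function of the history and the later variables. The passage rests on uniqueness of
  finite measures on product spaces, used once for each of the two coordinates. It also dictates the
  form of \<open>future\<close>: the uniform variables have to be integrated out beforehand, so that
  what follows treatment t is a function of the assigned past and of the exogenous variables after
  t. On the observed past the covariate equation returns the observed covariate, so the history is
  complete before the treatment is averaged. The versions \<open>pA\<close>, \<open>K\<close> and
  \<open>mu\<close> are determined only up to null sets. Bounds on probabilities and the identity P
  * ratio = Q therefore hold almost surely along the observed histories, and quotients with
  denominator 0 are harmless there because the numerator vanishes too.\<close>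

lemma pair_finite_measure_eqI:
  assumes sets: "sets N1 = sets (A \<Otimes>\<^sub>M B)" "sets N2 = sets (A \<Otimes>\<^sub>M B)"
    and fin: "emeasure N1 (space N1) \<noteq> \<infinity>"
    and eq: "\<And>C D. C \<in> sets A \<Longrightarrow> D \<in> sets B \<Longrightarrow> emeasure N1 (C \<times> D) = emeasure N2 (C \<times> D)"
  shows "N1 = N2"
\<comment> \<open>The whole space is itself a rectangle, of finite measure, so a constant sequence
  serves as the exhausting one.\<close>
proof (rule measure_eqI_generator_eq[where \<Omega>="space A \<times> space B"
      and E="{a \<times> b | a b. a \<in> sets A \<and> b \<in> sets B}" and A="\<lambda>_. space A \<times> space B"])
  show "Int_stable {a \<times> b |a b. a \<in> sets A \<and> b \<in> sets B}"
    by (rule Int_stable_pair_measure_generator)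
  show "{a \<times> b |a b. a \<in> sets A \<and> b \<in> sets B} \<subseteq> Pow (space A \<times> space B)"
    by (auto dest: sets.sets_into_space)
  show "emeasure N1 (space A \<times> space B) \<noteq> \<infinity>"
    using fin sets_eq_imp_space_eq[OF sets(1)] by (simp add: space_pair_measure)
qed (auto simp: sets sets_pair_measure eq)

lemma regression_subalgebra:
  assumes "prob_space M" "Z \<in> measurable M MZ"
  shows "sigma_finite_subalgebra M (vimage_algebra (space M) Z MZ)"
proof -
  interpret prob_space M by fact
  have "finite_measure_subalgebra M (vimage_algebra (space M) Z MZ)"
    using sets_image_in_sets[of M "space M" Z MZ] assms(2)
    by unfold_locales (auto simp: subalgebra_def)
  then show ?thesis
    by (rule finite_measure_subalgebra_is_sigma_finite)
qed

lemma measurable_vimage_compose: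
  assumes "Z \<in> measurable M MZ" "g \<in> measurable MZ N"
  shows "(\<lambda>\<omega>. g (Z \<omega>)) \<in> measurable (vimage_algebra (space M) Z MZ) N"
  using assms(1)
  by (intro measurable_compose[OF measurable_vimage_algebra1 assms(2)])
    (auto dest: measurable_space)

text \<open>The test function \<open>g\<close> may be unbounded as long as its product with
  \<open>W\<close> is integrable. This generality matters because the ratios Q / P, which enter
  \<open>g\<close> later, are not bounded.\<close>

lemma regression_integral:
  fixes W :: "'w \<Rightarrow> real"
  assumes "prob_space M" and Z: "Z \<in> measurable M MZ"
    and reg: "is_regression M Z MZ W phi"
    and W: "W \<in> borel_measurable M" and g: "g \<in> borel_measurable MZ"
    and int: "integrable M (\<lambda>\<omega>. g (Z \<omega>) * W \<omega>)"
  shows "integrable M (\<lambda>\<omega>. g (Z \<omega>) * phi (Z \<omega>))"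
    and "(\<integral>\<omega>. g (Z \<omega>) * phi (Z \<omega>) \<partial>M) = (\<integral>\<omega>. g (Z \<omega>) * W \<omega> \<partial>M)"
proof -
  let ?F = "vimage_algebra (space M) Z MZ"
  interpret sigma_finite_subalgebra M ?F
    using assms by (intro regression_subalgebra) auto
  have phi: "phi \<in> borel_measurable MZ"
    and ae: "AE \<omega> in M. phi (Z \<omega>) = real_cond_exp M ?F W \<omega>"
    using reg by (auto simp: is_regression_def)
  note c = real_cond_exp_intg[OF int measurable_vimage_compose[OF Z g] W]
  have ae2: "AE \<omega> in M. g (Z \<omega>) * real_cond_exp M ?F W \<omega> = g (Z \<omega>) * phi (Z \<omega>)"
    using ae by auto
  have m: "(\<lambda>\<omega>. g (Z \<omega>) * phi (Z \<omega>)) \<in> borel_measurable M"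
    using Z g phi by measurable
  show "integrable M (\<lambda>\<omega>. g (Z \<omega>) * phi (Z \<omega>))"
    by (rule integrable_cong_AE_imp[OF c(1) m]) (use ae2 in auto)
  have "(\<integral>\<omega>. g (Z \<omega>) * phi (Z \<omega>) \<partial>M) = (\<integral>\<omega>. g (Z \<omega>) * real_cond_exp M ?F W \<omega> \<partial>M)"
    using borel_measurable_integrable[OF c(1)] ae2 m by (intro integral_cong_AE) auto
  then show "(\<integral>\<omega>. g (Z \<omega>) * phi (Z \<omega>) \<partial>M) = (\<integral>\<omega>. g (Z \<omega>) * W \<omega> \<partial>M)"
    using c(2) by simp
qed

text \<open>A version of a regression is unconstrained off a null set, so the bounds can only be
  claimed almost surely and along \<open>Z\<close>. All sign facts about \<open>pA\<close> inherit
  this form.\<close>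

lemma regression_bounds:
  fixes W :: "'w \<Rightarrow> real"
  assumes "prob_space M" and Z: "Z \<in> measurable M MZ"
    and reg: "is_regression M Z MZ W phi"
    and W: "W \<in> borel_measurable M" "\<And>\<omega>. 0 \<le> W \<omega>" "\<And>\<omega>. W \<omega> \<le> 1"
  shows "AE \<omega> in M. 0 \<le> phi (Z \<omega>) \<and> phi (Z \<omega>) \<le> 1"
proof -
  let ?F = "vimage_algebra (space M) Z MZ"
  interpret prob_space M by fact
  interpret sigma_finite_subalgebra M ?F
    using assms by (intro regression_subalgebra) auto
  have "integrable M W"
    using W by (intro integrable_const_bound[of _ 1]) auto
  then have "AE \<omega> in M. 0 \<le> real_cond_exp M ?F W \<omega>" "AE \<omega> in M. real_cond_exp M ?F W \<omega> \<le> 1"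
    using W by (auto intro!: real_cond_exp_ge_c real_cond_exp_le_c)
  then show ?thesis
    using reg by (auto simp: is_regression_def)
qed

lemma is_regression_cong_AE:
  assumes "prob_space M" "Z \<in> measurable M MZ"
    and W: "W \<in> borel_measurable M" "W' \<in> borel_measurable M" "AE \<omega> in M. W \<omega> = W' \<omega>"
    and reg: "is_regression M Z MZ W phi"
  shows "is_regression M Z MZ W' phi"
proof -
  interpret sigma_finite_subalgebra M "vimage_algebra (space M) Z MZ"
    using assms(1,2) by (rule regression_subalgebra)
  show ?thesis
    using reg real_cond_exp_cong[OF W(3,1,2)] by (auto simp: is_regression_def)
qed

lemma is_regression_one_minus:
  assumes "prob_space M" "Z \<in> measurable M MZ" "integrable M W"
    and reg: "is_regression M Z MZ W phi"
  shows "is_regression M Z MZ (\<lambda>\<omega>. 1 - W \<omega>) (\<lambda>z. 1 - phi z)"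
proof -
  interpret prob_space M by fact
  interpret sigma_finite_subalgebra M "vimage_algebra (space M) Z MZ"
    using assms(1,2) by (rule regression_subalgebra)
  have "AE \<omega> in M. real_cond_exp M (vimage_algebra (space M) Z MZ) (\<lambda>_. 1) \<omega> = 1"
    by (rule real_cond_exp_F_meas) auto
  moreover have "AE \<omega> in M. real_cond_exp M (vimage_algebra (space M) Z MZ) (\<lambda>\<omega>. 1 - W \<omega>) \<omega>
      = real_cond_exp M (vimage_algebra (space M) Z MZ) (\<lambda>_. 1) \<omega>
        - real_cond_exp M (vimage_algebra (space M) Z MZ) W \<omega>"
    using assms(3) by (intro real_cond_exp_diff) auto
  moreover have "AE \<omega> in M. phi (Z \<omega>) = real_cond_exp M (vimage_algebra (space M) Z MZ) W \<omega>"
    using reg by (simp add: is_regression_def)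
  ultimately have "AE \<omega> in M. 1 - phi (Z \<omega>)
      = real_cond_exp M (vimage_algebra (space M) Z MZ) (\<lambda>\<omega>. 1 - W \<omega>) \<omega>"
    by eventually_elim simp
  moreover have "phi \<in> borel_measurable MZ"
    using reg by (simp add: is_regression_def)
  ultimately show ?thesis
    by (simp add: is_regression_def)
qed

lemma nn_integral_ennreal_eqI:
  assumes "integrable M f" "integrable M g" "integral\<^sup>L M f = integral\<^sup>L M g"
    and "AE x in M. 0 \<le> f x" "AE x in M. 0 \<le> g x"
  shows "(\<integral>\<^sup>+x. ennreal (f x) \<partial>M) = (\<integral>\<^sup>+x. ennreal (g x) \<partial>M)"
  using assms by (simp add: nn_integral_eq_integral)

text \<open>First coordinate of the extension. With \<open>B\<close> fixed, the two densities 1_B(W)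
  and g = E(1_B(W) | Z) push forward to the same measure under (Z, X). On a rectangle with
  indicators c, d: E[c d b] = E[c E(d b | Z)] = E[c g E(d | Z)] = E[c g d], the last step because c
  g is a function of Z.\<close>

lemma cond_indep_nn_integral_indicator:
  assumes "prob_space M"
    and [measurable]: "Z \<in> measurable M MZ" "X \<in> measurable M MX" "W \<in> measurable M MW"
    and ci: "cond_indep M Z MZ X MX W MW"
    and [measurable]: "E \<in> sets (MZ \<Otimes>\<^sub>M MX)" "B \<in> sets MW"
  shows "(\<integral>\<^sup>+\<omega>. indicator E (Z \<omega>, X \<omega>) * indicator B (W \<omega>) \<partial>M)
    = (\<integral>\<^sup>+\<omega>. indicator E (Z \<omega>, X \<omega>) *
        ennreal (real_cond_exp M (vimage_algebra (space M) Z MZ) (\<lambda>\<omega>. indicator B (W \<omega>)) \<omega>) \<partial>M)"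
proof -
  let ?F = "vimage_algebra (space M) Z MZ"
  interpret prob_space M by fact
  interpret sigma_finite_subalgebra M ?F
    using assms by (intro regression_subalgebra) auto
  define g where "g = real_cond_exp M ?F (\<lambda>\<omega>. indicator B (W \<omega>))"
  have gF[measurable]: "g \<in> borel_measurable ?F" and gM[measurable]: "g \<in> borel_measurable M"
    by (auto simp: g_def)
  have intB: "integrable M (\<lambda>\<omega>. indicator B (W \<omega>) :: real)"
    by (intro integrable_const_bound[of _ 1]) (auto simp: indicator_def)
  have g0: "AE \<omega> in M. 0 \<le> g \<omega>" and g1: "AE \<omega> in M. g \<omega> \<le> 1"
    unfolding g_def using intB by (auto intro!: real_cond_exp_ge_c real_cond_exp_le_c)
  have gb: "AE \<omega> in M. norm (g \<omega>) \<le> 1"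
    using g0 g1 by auto
  define N1 where "N1 = distr (density M (\<lambda>\<omega>. indicator B (W \<omega>))) (MZ \<Otimes>\<^sub>M MX) (\<lambda>\<omega>. (Z \<omega>, X \<omega>))"
  define N2 where "N2 = distr (density M (\<lambda>\<omega>. ennreal (g \<omega>))) (MZ \<Otimes>\<^sub>M MX) (\<lambda>\<omega>. (Z \<omega>, X \<omega>))"
  have e1: "emeasure N1 E' = (\<integral>\<^sup>+\<omega>. indicator E' (Z \<omega>, X \<omega>) * indicator B (W \<omega>) \<partial>M)"
    and e2: "emeasure N2 E' = (\<integral>\<^sup>+\<omega>. indicator E' (Z \<omega>, X \<omega>) * ennreal (g \<omega>) \<partial>M)"
    if [measurable]: "E' \<in> sets (MZ \<Otimes>\<^sub>M MX)" for E'
    unfolding N1_def N2_def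
    by (subst emeasure_distr, measurable, subst emeasure_density, measurable,
        auto intro!: nn_integral_cong simp: indicator_def)+
  have "N1 = N2"
  proof (rule pair_finite_measure_eqI)
    show "emeasure N1 (space N1) \<noteq> \<infinity>"
    proof -
      have "emeasure N1 (space N1) = (\<integral>\<^sup>+\<omega>. indicator (space N1) (Z \<omega>, X \<omega>) * indicator B (W \<omega>) \<partial>M)"
        by (rule e1) (auto simp: N1_def)
      also have "\<dots> \<le> (\<integral>\<^sup>+\<omega>. 1 \<partial>M)"
        by (intro nn_integral_mono) (auto simp: indicator_def)
      finally show ?thesis by (auto simp: emeasure_space_1 top_unique)
    qed
    fix C D assume [measurable]: "C \<in> sets MZ" "D \<in> sets MX"
    let ?c = "\<lambda>\<omega>. indicator C (Z \<omega>) :: real" and ?d = "\<lambda>\<omega>. indicator D (X \<omega>) :: real"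
      and ?b = "\<lambda>\<omega>. indicator B (W \<omega>) :: real"
    have cF[measurable]: "?c \<in> borel_measurable ?F"
      by (rule measurable_vimage_compose) auto
    have I1: "integrable M (\<lambda>\<omega>. ?c \<omega> * (?d \<omega> * ?b \<omega>))"
      by (intro integrable_const_bound[of _ 1]) (auto simp: indicator_def)
    have I2: "integrable M (\<lambda>\<omega>. (?c \<omega> * g \<omega>) * ?d \<omega>)"
      using gb by (intro integrable_const_bound[of _ 1]) (auto simp: indicator_def)
    have ae: "AE \<omega> in M. ?c \<omega> * real_cond_exp M ?F (\<lambda>\<omega>. ?d \<omega> * ?b \<omega>) \<omega>
        = (?c \<omega> * g \<omega>) * real_cond_exp M ?F ?d \<omega>"
    proof -
      have "AE \<omega> in M. real_cond_exp M ?F (\<lambda>\<omega>. ?d \<omega> * ?b \<omega>) \<omega> = real_cond_exp M ?F ?d \<omega> * g \<omega>"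
        using ci unfolding cond_indep_def g_def by simp
      then show ?thesis by eventually_elim simp
    qed
    have "(\<integral>\<omega>. ?c \<omega> * (?d \<omega> * ?b \<omega>) \<partial>M) = (\<integral>\<omega>. ?c \<omega> * real_cond_exp M ?F (\<lambda>\<omega>. ?d \<omega> * ?b \<omega>) \<omega> \<partial>M)"
      by (rule real_cond_exp_intg(2)[OF I1, symmetric]) auto
    also have "\<dots> = (\<integral>\<omega>. (?c \<omega> * g \<omega>) * real_cond_exp M ?F ?d \<omega> \<partial>M)"
      by (rule integral_cong_AE[OF _ _ ae]) auto
    also have "\<dots> = (\<integral>\<omega>. (?c \<omega> * g \<omega>) * ?d \<omega> \<partial>M)"
      by (rule real_cond_exp_intg(2)[OF I2]) auto
    finally have "(\<integral>\<^sup>+\<omega>. ennreal (?c \<omega> * (?d \<omega> * ?b \<omega>)) \<partial>M) = (\<integral>\<^sup>+\<omega>. ennreal ((?c \<omega> * g \<omega>) * ?d \<omega>) \<partial>M)"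
      using I1 I2 g0 by (intro nn_integral_ennreal_eqI) (auto simp: indicator_def)
    moreover have "emeasure N1 (C \<times> D) = (\<integral>\<^sup>+\<omega>. ennreal (?c \<omega> * (?d \<omega> * ?b \<omega>)) \<partial>M)"
      by (subst e1) (auto intro!: nn_integral_cong simp: indicator_def)
    moreover have "emeasure N2 (C \<times> D) = (\<integral>\<^sup>+\<omega>. ennreal ((?c \<omega> * g \<omega>) * ?d \<omega>) \<partial>M)"
      by (subst e2) (auto intro!: nn_integral_cong simp: indicator_def)
    ultimately show "emeasure N1 (C \<times> D) = emeasure N2 (C \<times> D)"
      by simp
  qed (auto simp: N1_def N2_def)
  then show ?thesis
    using e1[of E] e2[of E] by (simp add: g_def)
qed

text \<open>Second coordinate: now \<open>E\<close> is fixed and the densities 1_E(Z, X) and p(Z)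
  are compared under (Z, W). On a rectangle C x B the previous lemma trades 1_B(W) for its
  conditional expectation g, which depends on Z; then 1_E is replaced by p, and g is turned back
  into 1_B(W).\<close>

lemma cond_indep_nn_integral:
  assumes "prob_space M"
    and [measurable]: "Z \<in> measurable M MZ" "X \<in> measurable M MX" "W \<in> measurable M MW"
    and ci: "cond_indep M Z MZ X MX W MW"
    and [measurable]: "E \<in> sets (MZ \<Otimes>\<^sub>M MX)"
    and reg: "is_regression M Z MZ (\<lambda>\<omega>. indicator E (Z \<omega>, X \<omega>)) p"
    and [measurable]: "G \<in> borel_measurable (MZ \<Otimes>\<^sub>M MW)"
  shows "(\<integral>\<^sup>+\<omega>. indicator E (Z \<omega>, X \<omega>) * G (Z \<omega>, W \<omega>) \<partial>M)
    = (\<integral>\<^sup>+\<omega>. ennreal (p (Z \<omega>)) * G (Z \<omega>, W \<omega>) \<partial>M)"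
proof -
  let ?F = "vimage_algebra (space M) Z MZ"
  interpret prob_space M by fact
  interpret sigma_finite_subalgebra M ?F
    using assms by (intro regression_subalgebra) auto
  have [measurable]: "p \<in> borel_measurable MZ"
    using reg by (auto simp: is_regression_def)
  have pb: "AE \<omega> in M. 0 \<le> p (Z \<omega>) \<and> p (Z \<omega>) \<le> 1"
    by (rule regression_bounds[OF \<open>prob_space M\<close> _ reg]) (auto simp: indicator_def)
  define N1 where "N1 = distr (density M (\<lambda>\<omega>. indicator E (Z \<omega>, X \<omega>))) (MZ \<Otimes>\<^sub>M MW) (\<lambda>\<omega>. (Z \<omega>, W \<omega>))"
  define N2 where "N2 = distr (density M (\<lambda>\<omega>. ennreal (p (Z \<omega>)))) (MZ \<Otimes>\<^sub>M MW) (\<lambda>\<omega>. (Z \<omega>, W \<omega>))"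
  have e1: "integral\<^sup>N N1 H = (\<integral>\<^sup>+\<omega>. indicator E (Z \<omega>, X \<omega>) * H (Z \<omega>, W \<omega>) \<partial>M)"
    and e2: "integral\<^sup>N N2 H = (\<integral>\<^sup>+\<omega>. ennreal (p (Z \<omega>)) * H (Z \<omega>, W \<omega>) \<partial>M)"
    if [measurable]: "H \<in> borel_measurable (MZ \<Otimes>\<^sub>M MW)" for H
    unfolding N1_def N2_def
    by (subst nn_integral_distr, measurable, subst nn_integral_density, measurable)+
  have "N1 = N2"
  proof (rule pair_finite_measure_eqI)
    show "emeasure N1 (space N1) \<noteq> \<infinity>"
    proof -
      have "emeasure N1 (space N1) = integral\<^sup>N N1 (\<lambda>_. 1)"
        by simp
      also have "\<dots> = (\<integral>\<^sup>+\<omega>. indicator E (Z \<omega>, X \<omega>) * 1 \<partial>M)"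
        by (rule e1) auto
      also have "\<dots> \<le> (\<integral>\<^sup>+\<omega>. 1 \<partial>M)"
        by (intro nn_integral_mono) (auto simp: indicator_def)
      finally show ?thesis by (auto simp: emeasure_space_1 top_unique)
    qed
    fix C B assume [measurable]: "C \<in> sets MZ" "B \<in> sets MW"
    define g where "g = real_cond_exp M ?F (\<lambda>\<omega>. indicator B (W \<omega>))"
    have gF[measurable]: "g \<in> borel_measurable ?F" and gM[measurable]: "g \<in> borel_measurable M"
      by (auto simp: g_def)
    have intB: "integrable M (\<lambda>\<omega>. indicator B (W \<omega>) :: real)"
      by (intro integrable_const_bound[of _ 1]) (auto simp: indicator_def)
    have g0: "AE \<omega> in M. 0 \<le> g \<omega>" and g1: "AE \<omega> in M. g \<omega> \<le> 1"
      unfolding g_def using intB by (auto intro!: real_cond_exp_ge_c real_cond_exp_le_c)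
    let ?c = "\<lambda>\<omega>. indicator C (Z \<omega>) :: real" and ?e = "\<lambda>\<omega>. indicator E (Z \<omega>, X \<omega>) :: real"
      and ?b = "\<lambda>\<omega>. indicator B (W \<omega>) :: real"
    have cF[measurable]: "?c \<in> borel_measurable ?F" and pF[measurable]: "(\<lambda>\<omega>. p (Z \<omega>)) \<in> borel_measurable ?F"
      by (rule measurable_vimage_compose; simp)+
    have I1: "integrable M (\<lambda>\<omega>. (?c \<omega> * g \<omega>) * ?e \<omega>)"
      using g0 g1 by (intro integrable_const_bound[of _ 1]) (auto simp: indicator_def)
    have I2: "integrable M (\<lambda>\<omega>. (?c \<omega> * p (Z \<omega>)) * ?b \<omega>)"
      using pb by (intro integrable_const_bound[of _ 1]) (auto simp: indicator_def)
    have ae: "AE \<omega> in M. (?c \<omega> * g \<omega>) * real_cond_exp M ?F ?e \<omega> = (?c \<omega> * p (Z \<omega>)) * g \<omega>"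
      using reg unfolding is_regression_def by auto
    have "(\<integral>\<omega>. (?c \<omega> * g \<omega>) * ?e \<omega> \<partial>M) = (\<integral>\<omega>. (?c \<omega> * g \<omega>) * real_cond_exp M ?F ?e \<omega> \<partial>M)"
      by (rule real_cond_exp_intg(2)[OF I1, symmetric]) auto
    also have "\<dots> = (\<integral>\<omega>. (?c \<omega> * p (Z \<omega>)) * g \<omega> \<partial>M)"
      by (rule integral_cong_AE[OF _ _ ae]) auto
    also have "\<dots> = (\<integral>\<omega>. (?c \<omega> * p (Z \<omega>)) * ?b \<omega> \<partial>M)"
      unfolding g_def by (rule real_cond_exp_intg(2)[OF I2]) auto
    finally have *: "(\<integral>\<^sup>+\<omega>. ennreal ((?c \<omega> * g \<omega>) * ?e \<omega>) \<partial>M) = (\<integral>\<^sup>+\<omega>. ennreal ((?c \<omega> * p (Z \<omega>)) * ?b \<omega>) \<partial>M)"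
      using I1 I2 g0 pb by (intro nn_integral_ennreal_eqI) (auto simp: indicator_def)
    have "emeasure N1 (C \<times> B) = integral\<^sup>N N1 (indicator (C \<times> B))"
      by (simp add: N1_def)
    also have "\<dots> = (\<integral>\<^sup>+\<omega>. indicator E (Z \<omega>, X \<omega>) * indicator (C \<times> B) (Z \<omega>, W \<omega>) \<partial>M)"
      by (rule e1) auto
    \<comment> \<open>The factor 1_C(Z) is absorbed into the event on the pair (Z, X), the shape in
      which the preceding lemma applies.\<close>
    also have "\<dots> = (\<integral>\<^sup>+\<omega>. indicator (E \<inter> (C \<times> space MX)) (Z \<omega>, X \<omega>) * indicator B (W \<omega>) \<partial>M)"
      using measurable_space[OF \<open>X \<in> measurable M MX\<close>]
      by (intro nn_integral_cong) (auto simp: indicator_def)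
    also have "\<dots> = (\<integral>\<^sup>+\<omega>. indicator (E \<inter> (C \<times> space MX)) (Z \<omega>, X \<omega>) * ennreal (g \<omega>) \<partial>M)"
      unfolding g_def by (rule cond_indep_nn_integral_indicator) (use assms in auto)
    also have "\<dots> = (\<integral>\<^sup>+\<omega>. ennreal ((?c \<omega> * g \<omega>) * ?e \<omega>) \<partial>M)"
      using measurable_space[OF \<open>X \<in> measurable M MX\<close>]
      by (intro nn_integral_cong) (auto simp: indicator_def)
    also note *
    also have "(\<integral>\<^sup>+\<omega>. ennreal ((?c \<omega> * p (Z \<omega>)) * ?b \<omega>) \<partial>M)
      = (\<integral>\<^sup>+\<omega>. ennreal (p (Z \<omega>)) * indicator (C \<times> B) (Z \<omega>, W \<omega>) \<partial>M)"
      by (intro nn_integral_cong) (auto simp: indicator_def)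
    also have "\<dots> = integral\<^sup>N N2 (indicator (C \<times> B))"
      by (rule e2[symmetric]) auto
    also have "\<dots> = emeasure N2 (C \<times> B)"
      by (simp add: N2_def)
    finally show "emeasure N1 (C \<times> B) = emeasure N2 (C \<times> B)" .
  qed (auto simp: N1_def N2_def)
  then show ?thesis
    using e1[of G] e2[of G] by simp
qed

text \<open>Disintegration of the law of (Z, X): by uniqueness it is enough that the mixture of the
  laws \<open>K z\<close> over the law of Z gives rectangles the right mass, which is the regression
  property tested against 1_C(Z).\<close>

lemma kernel_nn_integral:
  assumes "prob_space M"
    and [measurable]: "Z \<in> measurable M MZ" "X \<in> measurable M N"
    and K: "K \<in> measurable MZ (prob_algebra N)"
    and reg: "\<And>B. B \<in> sets N \<Longrightarrow> is_regression M Z MZ (\<lambda>\<omega>. indicator B (X \<omega>)) (\<lambda>z. measure (K z) B)"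
    and [measurable]: "g \<in> borel_measurable (MZ \<Otimes>\<^sub>M N)"
  shows "(\<integral>\<^sup>+\<omega>. g (Z \<omega>, X \<omega>) \<partial>M) = (\<integral>\<^sup>+\<omega>. (\<integral>\<^sup>+x. g (Z \<omega>, x) \<partial>K (Z \<omega>)) \<partial>M)"
proof -
  interpret prob_space M by fact
  have K'[measurable]: "K \<in> measurable MZ (subprob_algebra N)"
    using K by (rule measurable_prob_algebraD)
  have pK: "prob_space (K z)" "sets (K z) = sets N" if "z \<in> space MZ" for z
    using measurable_space[OF K that] by (auto simp: space_prob_algebra)
  define N1 where "N1 = distr M (MZ \<Otimes>\<^sub>M N) (\<lambda>\<omega>. (Z \<omega>, X \<omega>))"
  \<comment> \<open>\<open>k\<close> is the law of a pair whose first entry is frozen at Z and whose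
    second is drawn from the kernel; binding it over \<open>M\<close> yields the candidate joint
    law.\<close>
  define k where "k = (\<lambda>\<omega>. distr (K (Z \<omega>)) (MZ \<Otimes>\<^sub>M N) (Pair (Z \<omega>)))"
  have k[measurable]: "k \<in> measurable M (subprob_algebra (MZ \<Otimes>\<^sub>M N))"
    unfolding k_def
    by (rule measurable_distr2[where M=N]) (auto intro!: measurable_compose[OF _ K'])
  define N2 where "N2 = M \<bind> k"
  have e1: "integral\<^sup>N N1 H = (\<integral>\<^sup>+\<omega>. H (Z \<omega>, X \<omega>) \<partial>M)"
    and e2: "integral\<^sup>N N2 H = (\<integral>\<^sup>+\<omega>. (\<integral>\<^sup>+x. H (Z \<omega>, x) \<partial>K (Z \<omega>)) \<partial>M)"
    if [measurable]: "H \<in> borel_measurable (MZ \<Otimes>\<^sub>M N)" for H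
  proof -
    show "integral\<^sup>N N1 H = (\<integral>\<^sup>+\<omega>. H (Z \<omega>, X \<omega>) \<partial>M)"
      unfolding N1_def by (rule nn_integral_distr) auto
    have "integral\<^sup>N N2 H = (\<integral>\<^sup>+\<omega>. integral\<^sup>N (k \<omega>) H \<partial>M)"
      unfolding N2_def by (rule nn_integral_bind[OF that k])
    also have "\<dots> = (\<integral>\<^sup>+\<omega>. (\<integral>\<^sup>+x. H (Z \<omega>, x) \<partial>K (Z \<omega>)) \<partial>M)"
    proof (intro nn_integral_cong)
      fix \<omega> assume "\<omega> \<in> space M"
      then have z: "Z \<omega> \<in> space MZ" using measurable_space[of Z M MZ] by auto
      then show "integral\<^sup>N (k \<omega>) H = (\<integral>\<^sup>+x. H (Z \<omega>, x) \<partial>K (Z \<omega>))"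
        unfolding k_def using measurable_Pair1'[OF z, of N] pK(2)[OF z]
        by (intro nn_integral_distr) (auto cong: measurable_cong_sets)
    qed
    finally show "integral\<^sup>N N2 H = (\<integral>\<^sup>+\<omega>. (\<integral>\<^sup>+x. H (Z \<omega>, x) \<partial>K (Z \<omega>)) \<partial>M)" .
  qed
  have sN2: "sets N2 = sets (MZ \<Otimes>\<^sub>M N)"
    unfolding N2_def by (rule sets_bind[where N="MZ \<Otimes>\<^sub>M N"])
      (use measurable_space[OF k] not_empty in \<open>auto simp: space_subprob_algebra\<close>)
  have "N1 = N2"
  proof (rule pair_finite_measure_eqI)
    show "emeasure N1 (space N1) \<noteq> \<infinity>"
      using e1[of "\<lambda>_. 1"] by (simp add: emeasure_space_1)
    fix C B assume [measurable]: "C \<in> sets MZ" "B \<in> sets N"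
    let ?c = "\<lambda>z. indicator C z :: real"
    have I: "integrable M (\<lambda>\<omega>. ?c (Z \<omega>) * indicator B (X \<omega>))"
      by (intro integrable_const_bound[of _ 1]) (auto simp: indicator_def)
    note r = regression_integral[OF \<open>prob_space M\<close> _ reg _ _ I]
    have "(\<integral>\<^sup>+\<omega>. ennreal (?c (Z \<omega>) * indicator B (X \<omega>)) \<partial>M)
        = (\<integral>\<^sup>+\<omega>. ennreal (?c (Z \<omega>) * measure (K (Z \<omega>)) B) \<partial>M)"
      using I r by (intro nn_integral_ennreal_eqI) (auto simp: indicator_def)
    also have "\<dots> = (\<integral>\<^sup>+\<omega>. (\<integral>\<^sup>+x. indicator (C \<times> B) (Z \<omega>, x) \<partial>K (Z \<omega>)) \<partial>M)"
    proof (intro nn_integral_cong)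
      fix \<omega> assume "\<omega> \<in> space M"
      then have z: "Z \<omega> \<in> space MZ" using measurable_space[of Z M MZ] by auto
      interpret Kz: prob_space "K (Z \<omega>)" by (rule pK(1)[OF z])
      have "(\<integral>\<^sup>+x. indicator (C \<times> B) (Z \<omega>, x) \<partial>K (Z \<omega>)) = (\<integral>\<^sup>+x. indicator C (Z \<omega>) * indicator B x \<partial>K (Z \<omega>))"
        by (intro nn_integral_cong) (auto simp: indicator_def)
      also have "\<dots> = indicator C (Z \<omega>) * emeasure (K (Z \<omega>)) B"
        by (subst nn_integral_cmult_indicator) (auto simp: pK(2)[OF z])
      finally show "ennreal (?c (Z \<omega>) * measure (K (Z \<omega>)) B) = (\<integral>\<^sup>+x. indicator (C \<times> B) (Z \<omega>, x) \<partial>K (Z \<omega>))"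
        by (auto simp: Kz.emeasure_eq_measure indicator_def)
    qed
    also have "\<dots> = integral\<^sup>N N2 (indicator (C \<times> B))"
      by (rule e2[symmetric]) auto
    also have "\<dots> = emeasure N2 (C \<times> B)"
      by (simp add: sN2)
    finally have "emeasure N2 (C \<times> B) = (\<integral>\<^sup>+\<omega>. ennreal (?c (Z \<omega>) * indicator B (X \<omega>)) \<partial>M)" ..
    also have "\<dots> = (\<integral>\<^sup>+\<omega>. indicator (C \<times> B) (Z \<omega>, X \<omega>) \<partial>M)"
      by (intro nn_integral_cong) (auto simp: indicator_def)
    also have "\<dots> = integral\<^sup>N N1 (indicator (C \<times> B))"
      by (rule e1[symmetric]) auto
    also have "\<dots> = emeasure N1 (C \<times> B)"
      by (simp add: N1_def)
    finally show "emeasure N1 (C \<times> B) = emeasure N2 (C \<times> B)" ..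
  qed (auto simp: N1_def sN2)
  then show ?thesis
    using e1[of g] e2[of g] by simp
qed

text \<open>The parameter z occurs both in the measure and in the integrand. Pushing
  \<open>K z\<close> forward along \<open>Pair z\<close> moves it into the measure alone, leaving a
  fixed integrand on the product space.\<close>

lemma kernel_integral_measurable:
  fixes g :: "'z \<times> 'x \<Rightarrow> real"
  assumes K[measurable]: "K \<in> measurable MZ (subprob_algebra N)"
    and g[measurable]: "g \<in> borel_measurable (MZ \<Otimes>\<^sub>M N)"
  shows "(\<lambda>z. \<integral>x. g (z, x) \<partial>K z) \<in> borel_measurable MZ"
proof -
  have sK: "sets (K z) = sets N" if "z \<in> space MZ" for z
    using measurable_space[OF K that] by (auto simp: space_subprob_algebra)
  have [measurable]: "(\<lambda>z. distr (K z) (MZ \<Otimes>\<^sub>M N) (Pair z)) \<in> measurable MZ (subprob_algebra (MZ \<Otimes>\<^sub>M N))"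
    by (rule measurable_distr2[where M=N]) auto
  have "(\<lambda>z. integral\<^sup>L (distr (K z) (MZ \<Otimes>\<^sub>M N) (Pair z)) g) \<in> borel_measurable MZ"
    by (rule measurable_compose[OF _ integral_measurable_subprob_algebra[OF g]]) auto
  then show ?thesis
  proof (rule measurable_cong[THEN iffD1, rotated])
    fix z assume z: "z \<in> space MZ"
    then have "Pair z \<in> measurable (K z) (MZ \<Otimes>\<^sub>M N)"
      using measurable_Pair1'[OF z, of N] sK[OF z] by (simp cong: measurable_cong_sets)
    then show "integral\<^sup>L (distr (K z) (MZ \<Otimes>\<^sub>M N) (Pair z)) g = (\<integral>x. g (z, x) \<partial>K z)"
      by (intro integral_distr) auto
  qed
qed

lemma kernel_integral:
  fixes g :: "'z \<times> 'x \<Rightarrow> real"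
  assumes "prob_space M"
    and [measurable]: "Z \<in> measurable M MZ" "X \<in> measurable M N"
    and K: "K \<in> measurable MZ (prob_algebra N)"
    and reg: "\<And>B. B \<in> sets N \<Longrightarrow> is_regression M Z MZ (\<lambda>\<omega>. indicator B (X \<omega>)) (\<lambda>z. measure (K z) B)"
    and [measurable]: "g \<in> borel_measurable (MZ \<Otimes>\<^sub>M N)"
    and int: "integrable M (\<lambda>\<omega>. g (Z \<omega>, X \<omega>))"
  shows "integrable M (\<lambda>\<omega>. \<integral>x. g (Z \<omega>, x) \<partial>K (Z \<omega>))" (is ?i)
    and "(\<integral>\<omega>. (\<integral>x. g (Z \<omega>, x) \<partial>K (Z \<omega>)) \<partial>M) = (\<integral>\<omega>. g (Z \<omega>, X \<omega>) \<partial>M)" (is ?e)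
proof -
  interpret prob_space M by fact
  have K'[measurable]: "K \<in> measurable MZ (subprob_algebra N)"
    using K by (rule measurable_prob_algebraD)
  have sK: "sets (K z) = sets N" if "z \<in> space MZ" for z
    using measurable_space[OF K that] by (auto simp: space_prob_algebra)
  have mg: "(\<lambda>x. g (z, x)) \<in> borel_measurable (K z)" if "z \<in> space MZ" for z
    using that sK[OF that] by (auto cong: measurable_cong_sets)
  \<comment> \<open>Since \<open>ennreal\<close> truncates at 0, s = 1 and s = -1 give the integrals
    of the positive and the negative part.\<close>
  define P where "P = (\<lambda>s z. \<integral>\<^sup>+x. ennreal (s * g (z, x)) \<partial>K z)"
  have [measurable]: "P s \<in> borel_measurable MZ" for s
    unfolding P_def by (rule nn_integral_measurable_subprob_algebra2[where N=N]) auto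
  have m: "(\<lambda>z. \<integral>x. g (z, x) \<partial>K z) \<in> borel_measurable MZ"
    by (rule kernel_integral_measurable[where N=N]) auto
  have P: "(\<integral>\<^sup>+\<omega>. P s (Z \<omega>) \<partial>M) = (\<integral>\<^sup>+\<omega>. ennreal (s * g (Z \<omega>, X \<omega>)) \<partial>M)" for s
    unfolding P_def using kernel_nn_integral[OF assms(1-5), of "\<lambda>p. ennreal (s * g p)"] by simp
  have fin: "(\<integral>\<^sup>+\<omega>. P 1 (Z \<omega>) \<partial>M) \<noteq> \<infinity>" "(\<integral>\<^sup>+\<omega>. P (-1) (Z \<omega>) \<partial>M) \<noteq> \<infinity>"
    using int unfolding P real_integrable_def by auto
  then have ae: "AE \<omega> in M. P 1 (Z \<omega>) \<noteq> \<infinity>" "AE \<omega> in M. P (-1) (Z \<omega>) \<noteq> \<infinity>"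
    by (auto intro!: nn_integral_PInf_AE simp flip: infinity_ennreal_def)
  have Ienn: "integrable M (\<lambda>\<omega>. enn2real (P s (Z \<omega>)))"
    and Eenn: "(\<integral>\<omega>. enn2real (P s (Z \<omega>)) \<partial>M) = enn2real (\<integral>\<^sup>+\<omega>. ennreal (s * g (Z \<omega>, X \<omega>)) \<partial>M)"
    if s: "s = 1 \<or> s = -1" for s
  proof -
    have *: "(\<integral>\<^sup>+\<omega>. ennreal (enn2real (P s (Z \<omega>))) \<partial>M) = (\<integral>\<^sup>+\<omega>. P s (Z \<omega>) \<partial>M)"
      using ae s by (intro nn_integral_cong_AE) (auto simp: less_top)
    then show "integrable M (\<lambda>\<omega>. enn2real (P s (Z \<omega>)))"
      using fin s by (intro integrableI_nonneg) (auto simp: less_top)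
    show "(\<integral>\<omega>. enn2real (P s (Z \<omega>)) \<partial>M) = enn2real (\<integral>\<^sup>+\<omega>. ennreal (s * g (Z \<omega>, X \<omega>)) \<partial>M)"
      using * P by (subst integral_eq_nn_integral) auto
  qed
  \<comment> \<open>Where both parts are finite the inner integral is their difference. On the
    remaining null set it may be a default value, which does not affect the outer integral.\<close>
  have dec: "AE \<omega> in M. (\<integral>x. g (Z \<omega>, x) \<partial>K (Z \<omega>)) = enn2real (P 1 (Z \<omega>)) - enn2real (P (-1) (Z \<omega>))"
    using ae AE_space
  proof eventually_elim
    case (elim \<omega>)
    have "Z \<omega> \<in> space MZ"
      using elim(3) by (rule measurable_space[OF \<open>Z \<in> measurable M MZ\<close>])
    then have "integrable (K (Z \<omega>)) (\<lambda>x. g (Z \<omega>, x))"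
      using mg elim by (simp add: real_integrable_def P_def)
    from real_lebesgue_integral_def[OF this] show ?case
      by (simp only: P_def mult_minus1 mult_1)
  qed
  have dI: "integrable M (\<lambda>\<omega>. enn2real (P 1 (Z \<omega>)) - enn2real (P (-1) (Z \<omega>)))"
    using Ienn by auto
  show ?i
    by (rule integrable_cong_AE_imp[OF dI]) (use m dec in \<open>auto intro: measurable_compose\<close>)
  have "(\<integral>\<omega>. (\<integral>x. g (Z \<omega>, x) \<partial>K (Z \<omega>)) \<partial>M) = (\<integral>\<omega>. enn2real (P 1 (Z \<omega>)) - enn2real (P (-1) (Z \<omega>)) \<partial>M)"
    using dec m by (intro integral_cong_AE) (auto intro: measurable_compose)
  also have "\<dots> = (\<integral>\<omega>. g (Z \<omega>, X \<omega>) \<partial>M)"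
    using Ienn Eenn by (subst Bochner_Integration.integral_diff)
      (auto simp: real_lebesgue_integral_def[OF int])
  finally show ?e .
qed

text \<open>Fubini for independent variables, with the independent copy of Y realized as a second
  integral over the same space \<open>M\<close>.\<close>

lemma nn_integral_distr_prod:
  assumes "prob_space M"
    and [measurable]: "X \<in> measurable M A" "Y \<in> measurable M B"
    and eq: "distr M (A \<Otimes>\<^sub>M B) (\<lambda>\<omega>. (X \<omega>, Y \<omega>)) = distr M A X \<Otimes>\<^sub>M distr M B Y"
    and [measurable]: "F \<in> borel_measurable (A \<Otimes>\<^sub>M B)"
  shows "(\<integral>\<^sup>+\<omega>. F (X \<omega>, Y \<omega>) \<partial>M) = (\<integral>\<^sup>+\<omega>. (\<integral>\<^sup>+\<omega>'. F (X \<omega>, Y \<omega>') \<partial>M) \<partial>M)"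
proof -
  interpret prob_space M by fact
  interpret Y: prob_space "distr M B Y"
    by (rule prob_space_distr) simp
  have "(\<integral>\<^sup>+\<omega>. F (X \<omega>, Y \<omega>) \<partial>M) = (\<integral>\<^sup>+p. F p \<partial>(distr M A X \<Otimes>\<^sub>M distr M B Y))"
    by (subst eq[symmetric], subst nn_integral_distr) auto
  also have "\<dots> = (\<integral>\<^sup>+x. \<integral>\<^sup>+y. F (x, y) \<partial>distr M B Y \<partial>distr M A X)"
    by (rule Y.nn_integral_fst[symmetric]) simp
  also have "\<dots> = (\<integral>\<^sup>+\<omega>. \<integral>\<^sup>+y. F (X \<omega>, y) \<partial>distr M B Y \<partial>M)"
    by (rule nn_integral_distr) (auto intro!: Y.borel_measurable_nn_integral)
  also have "\<dots> = (\<integral>\<^sup>+\<omega>. (\<integral>\<^sup>+\<omega>'. F (X \<omega>, Y \<omega>') \<partial>M) \<partial>M)"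
    by (intro nn_integral_cong nn_integral_distr) (auto dest: measurable_space)
  finally show ?thesis .
qed

section \<open>Counterfactual and observed pasts\<close>

definition add_cov :: "nat \<Rightarrow> 'x hist \<Rightarrow> 'x \<Rightarrow> 'x hist" where
  "add_cov t p x = ((fst p)(t := x), snd p)"

definition add_trt :: "nat \<Rightarrow> 'x hist \<Rightarrow> bool \<Rightarrow> 'x hist" where
  "add_trt t h b = (fst h, (snd h)(t := b))"

text \<open>Cutting after the treatment, where \<open>cfH\<close> cuts before it, makes one
  recursion step consist of covariate, natural treatment and decision of a single time point,
  without the special case that \<open>cfH\<close> has at time 0.\<close>

primrec cf_past :: "('w, 'x, 'ux, 'ua, 'uy, 'z) scm_scheme \<Rightarrow> 'x regime \<Rightarrow> nat \<Rightarrow> 'w \<Rightarrow> 'x hist" where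
  "cf_past S g 0 \<omega> = (\<lambda>_. undefined, \<lambda>_. undefined)"
| "cf_past S g (Suc n) \<omega> =
     (let h = add_cov (Suc n) (cf_past S g n \<omega>) (fX S (Suc n) (cf_past S g n \<omega>) (UX S (Suc n) \<omega>))
      in add_trt (Suc n) h (g (Suc n) h (fA S (Suc n) h (UA S (Suc n) \<omega>)) (V S (Suc n) \<omega>)))"

lemma cfH_Suc:
  "cfH S g (Suc n) \<omega> = add_cov (Suc n) (cf_past S g n \<omega>) (fX S (Suc n) (cf_past S g n \<omega>) (UX S (Suc n) \<omega>))"
proof (induction n)
  case (Suc n)
  show ?case
    by (subst cfH.simps, subst Suc.IH) (simp add: add_cov_def add_trt_def Let_def)
qed (simp add: add_cov_def)

lemma cf_past_Suc: "cf_past S g (Suc n) \<omega> = add_trt (Suc n) (cfH S g (Suc n) \<omega>) (cfD S g (Suc n) \<omega>)"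
  by (simp add: cfH_Suc cfD_def cfNatA_def Let_def del: cfH.simps)

lemma cfY_eq_cf_past:
  assumes "1 \<le> T"
  shows "cfY S T g \<omega> = fY S (cf_past S g T \<omega>) (UY S \<omega>)"
  using assms by (cases T) (simp_all add: cfY_def cf_past_Suc add_trt_def del: cfH.simps cf_past.simps)

lemma cfD_eq_cf_past:
  assumes "1 \<le> t"
  shows "cfD S g t \<omega> = snd (cf_past S g t \<omega>) t"
  using assms by (cases t) (simp_all add: cf_past_Suc add_trt_def del: cfH.simps cf_past.simps)

lemma obsH_Suc: "obsH S (Suc n) \<omega> = add_cov (Suc n) (obsPrev S (Suc n) \<omega>) (obsX S (Suc n) \<omega>)"
  by (auto simp: obsH_def obsPrev_def add_cov_def fun_eq_iff)

lemma obsPrev_Suc_Suc: "obsPrev S (Suc (Suc n)) \<omega> = add_trt (Suc n) (obsH S (Suc n) \<omega>) (obsA S (Suc n) \<omega>)"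
  by (auto simp: obsH_def obsPrev_def add_trt_def fun_eq_iff)

text \<open>Consistency in the form used below: observed data arise under the natural regime. The
  index shifts because \<open>obsPrev S t\<close> stops strictly before t; both sides are
  \<open>undefined\<close> outside times 1 to n, so they agree as functions.\<close>

lemma obsPrev_eq_cf_past: "obsPrev S (Suc n) \<omega> = cf_past S natural_regime n \<omega>"
proof (induction n)
  case 0
  then show ?case by (simp add: obsPrev_def restrict_def)
next
  case (Suc n)
  have "obsH S (Suc n) \<omega> = cfH S natural_regime (Suc n) \<omega>"
    unfolding obsH_Suc Suc.IH obsX_def by (simp add: cfH_Suc add_cov_def del: cfH.simps)
  then show ?case
    unfolding obsPrev_Suc_Suc cf_past_Suc by (simp add: obsA_def)
qed

lemma obsX_eq: "obsX S (Suc n) \<omega> = fX S (Suc n) (obsPrev S (Suc n) \<omega>) (UX S (Suc n) \<omega>)"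
  by (simp add: obsPrev_eq_cf_past obsX_def cfH_Suc add_cov_def del: cfH.simps)

lemma obsH_eq_cfH: "obsH S (Suc n) \<omega> = cfH S natural_regime (Suc n) \<omega>"
  by (simp add: obsH_Suc obsX_eq obsPrev_eq_cf_past cfH_Suc del: cfH.simps)

lemma obsA_eq:
  assumes "1 \<le> t"
  shows "obsA S t \<omega> = fA S t (obsH S t \<omega>) (UA S t \<omega>)"
  using assms
  by (cases t) (simp_all add: obsH_eq_cfH obsA_def cfD_def cfNatA_def natural_regime_def del: cfH.simps)

text \<open>The two models may live on different sample spaces, which permits evaluating the
  recursion on a space of exogenous values in place of \<open>M\<close>.\<close>

lemma cf_past_cong:
  assumes "fX S = fX S'" "fA S = fA S'"
    and "\<And>t. t \<in> {1..n} \<Longrightarrow> UX S t \<omega> = UX S' t \<omega>'"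
    and "\<And>t. t \<in> {1..n} \<Longrightarrow> UA S t \<omega> = UA S' t \<omega>'"
    and "\<And>t. t \<in> {1..n} \<Longrightarrow> V S t \<omega> = V S' t \<omega>'"
  shows "cf_past S g n \<omega> = cf_past S' g n \<omega>'"
  using assms(3-) by (induction n) (simp_all add: assms(1,2))

lemma measurable_add_cov [measurable (raw)]:
  assumes p: "p \<in> measurable N (PrevM t)" and x: "x \<in> measurable N borel" and "1 \<le> t"
  shows "(\<lambda>\<omega>. add_cov t (p \<omega>) (x \<omega>)) \<in> measurable N (HistM t)"
proof -
  have "(\<lambda>\<omega>. (fst (p \<omega>))(t := x \<omega>)) \<in> measurable N (PiM {1..t} (\<lambda>_. borel))"
    using p x \<open>1 \<le> t\<close> unfolding PrevM_def by (intro measurable_fun_upd[where J="{1..<t}"]) auto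
  moreover have "(\<lambda>\<omega>. snd (p \<omega>)) \<in> measurable N (PiM {1..<t} (\<lambda>_. count_space UNIV))"
    using p unfolding PrevM_def by measurable
  ultimately show ?thesis
    unfolding HistM_def add_cov_def by (rule measurable_Pair)
qed

lemma measurable_add_trt [measurable (raw)]:
  assumes h: "h \<in> measurable N (HistM t)" and b: "b \<in> measurable N (count_space UNIV)" and "1 \<le> t"
  shows "(\<lambda>\<omega>. add_trt t (h \<omega>) (b \<omega>)) \<in> measurable N (PrevM (Suc t))"
proof -
  have "(\<lambda>\<omega>. (snd (h \<omega>))(t := b \<omega>)) \<in> measurable N (PiM {1..<Suc t} (\<lambda>_. count_space UNIV))"
    using h b \<open>1 \<le> t\<close> unfolding HistM_def by (intro measurable_fun_upd[where J="{1..<t}"]) auto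
  moreover have "(\<lambda>\<omega>. fst (h \<omega>)) \<in> measurable N (PiM {1..<Suc t} (\<lambda>_. borel))"
    using h unfolding HistM_def by (simp add: atLeastLessThanSuc_atLeastAtMost)
  ultimately show ?thesis
    unfolding PrevM_def add_trt_def by (intro measurable_Pair)
qed

lemma cf_past_measurable:
  fixes S :: "('w, 'x::topological_space, 'ux, 'ua, 'uy, 'z) scm_scheme"
  assumes fX: "\<And>t. t \<in> {1..n} \<Longrightarrow> (\<lambda>(h, u). fX S t h u) \<in> measurable (PrevM t \<Otimes>\<^sub>M UXM t) borel"
    and fA: "\<And>t. t \<in> {1..n} \<Longrightarrow> (\<lambda>(h, u). fA S t h u) \<in> measurable (HistM t \<Otimes>\<^sub>M UAM t) (count_space UNIV)"
    and g: "\<And>t. t \<in> {1..n} \<Longrightarrow> (\<lambda>(h, b, v). g t h b v)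
        \<in> measurable (HistM t \<Otimes>\<^sub>M count_space UNIV \<Otimes>\<^sub>M borel) (count_space UNIV)"
    and UX: "\<And>t. t \<in> {1..n} \<Longrightarrow> UX S t \<in> measurable N (UXM t)"
    and UA: "\<And>t. t \<in> {1..n} \<Longrightarrow> UA S t \<in> measurable N (UAM t)"
    and V: "\<And>t. t \<in> {1..n} \<Longrightarrow> V S t \<in> borel_measurable N"
  shows "cf_past S g n \<in> measurable N (PrevM (Suc n))"
  using assms
proof (induction n)
  case 0
  have "cf_past S g 0 = (\<lambda>_. (\<lambda>_. undefined, \<lambda>_. undefined))"
    by (rule ext) simp
  then show ?case
    by (auto simp: PrevM_def PiM_empty space_pair_measure)
next
  case (Suc n)
  have n: "Suc n \<in> {1..Suc n}"
    by simp
  have p: "cf_past S g n \<in> measurable N (PrevM (Suc n))"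
    using Suc.prems by (intro Suc.IH) auto
  let ?h = "\<lambda>\<omega>. add_cov (Suc n) (cf_past S g n \<omega>) (fX S (Suc n) (cf_past S g n \<omega>) (UX S (Suc n) \<omega>))"
  let ?a = "\<lambda>\<omega>. fA S (Suc n) (?h \<omega>) (UA S (Suc n) \<omega>)"
  have x: "(\<lambda>\<omega>. fX S (Suc n) (cf_past S g n \<omega>) (UX S (Suc n) \<omega>)) \<in> measurable N borel"
    using measurable_compose[OF measurable_Pair[OF p Suc.prems(4)[OF n]] Suc.prems(1)[OF n]] by simp
  have h: "?h \<in> measurable N (HistM (Suc n))"
    using p x by (intro measurable_add_cov) auto
  have a: "?a \<in> measurable N (count_space UNIV)"
    using measurable_compose[OF measurable_Pair[OF h Suc.prems(5)[OF n]] Suc.prems(2)[OF n]] by simp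
  have "(\<lambda>\<omega>. g (Suc n) (?h \<omega>) (?a \<omega>) (V S (Suc n) \<omega>)) \<in> measurable N (count_space UNIV)"
    using measurable_compose[OF measurable_Pair[OF h measurable_Pair[OF a Suc.prems(6)[OF n]]] Suc.prems(3)[OF n]]
    by simp
  from measurable_add_trt[OF h this] show ?case
    by (simp add: Let_def)
qed

section \<open>Measurability of the regimes and the law of a single flip\<close>

lemma natural_regime_measurable:
  "(\<lambda>(h, b, v). natural_regime t h b v) \<in> measurable (N \<Otimes>\<^sub>M count_space UNIV \<Otimes>\<^sub>M borel) (count_space UNIV)"
  by (simp add: natural_regime_def case_prod_beta)

lemma flip_regime_measurable:
  assumes [measurable]: "f t \<in> borel_measurable N"
  shows "(\<lambda>(h, b, v). flip_regime a f t h b v)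
    \<in> measurable (N \<Otimes>\<^sub>M count_space UNIV \<Otimes>\<^sub>M borel) (count_space UNIV)"
  unfolding flip_regime_def case_prod_beta by measurable

text \<open>Probability, over a uniform variable, that a flip step turns the natural value
  \<open>n\<close> into \<open>b\<close>.\<close>

definition flip_prob :: "(nat \<Rightarrow> bool) \<Rightarrow> (nat \<Rightarrow> 'x hist \<Rightarrow> real) \<Rightarrow> nat \<Rightarrow> 'x hist \<Rightarrow> bool \<Rightarrow> bool \<Rightarrow> real" where
  "flip_prob a f t h n b =
     (if n = a t then of_bool (b = a t) else if b = a t then f t h else 1 - f t h)"

lemma flip_prob_measurable:
  assumes [measurable]: "f t \<in> borel_measurable N"
    "h \<in> measurable R N" "n \<in> measurable R (count_space UNIV)"
  shows "(\<lambda>\<omega>. flip_prob a f t (h \<omega>) (n \<omega>) b) \<in> borel_measurable R"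
  unfolding flip_prob_def by measurable

text \<open>Law of total probability: Q is the law of the treatment obtained by drawing the natural
  value from P and then flipping it. As an algebraic identity it requires no bounds on
  \<open>pA\<close> and \<open>f\<close>.\<close>

lemma Qf_eq_sum_flip_prob: "Qf pA f a t b h = (\<Sum>n\<in>UNIV. pAt pA t n h * flip_prob a f t h n b)"
  by (cases "a t"; cases b) (simp_all add: Qf_def pAt_def flip_prob_def UNIV_bool Let_def algebra_simps)

lemma emeasure_uniform_le:
  assumes "0 \<le> c" "c \<le> 1"
  shows "emeasure (uniform_measure lborel {0..1::real}) {v. v \<le> c} = ennreal c"
    and "emeasure (uniform_measure lborel {0..1::real}) {v. \<not> v \<le> c} = ennreal (1 - c)"
proof -
  have *: "{0..1} \<inter> {v. v \<le> c} = {0..c}" "{0..1} \<inter> {v. \<not> v \<le> c} = {c<..1}"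
    using assms by auto
  show "emeasure (uniform_measure lborel {0..1::real}) {v. v \<le> c} = ennreal c"
    using assms by (subst emeasure_uniform_measure) (auto simp: * divide_ennreal_def)
  show "emeasure (uniform_measure lborel {0..1::real}) {v. \<not> v \<le> c} = ennreal (1 - c)"
    using assms by (subst emeasure_uniform_measure) (auto simp: * divide_ennreal_def)
qed

lemma nn_integral_flip_regime:
  fixes G :: "bool \<Rightarrow> ennreal"
  assumes "0 \<le> f t h" "f t h \<le> 1"
  shows "(\<integral>\<^sup>+v. G (flip_regime a f t h n v) \<partial>uniform_measure lborel {0..1})
    = (\<Sum>b\<in>UNIV. ennreal (flip_prob a f t h n b) * G b)"
proof -
  let ?U = "uniform_measure lborel {0..1::real}"
  interpret U: prob_space ?U
    by (rule prob_space_uniform_measure) auto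
  have "(\<integral>\<^sup>+v. G (if v \<le> f t h then b else \<not> b) \<partial>?U)
      = ennreal (f t h) * G b + ennreal (1 - f t h) * G (\<not> b)" for b
  proof -
    have "(\<integral>\<^sup>+v. G (if v \<le> f t h then b else \<not> b) \<partial>?U)
        = (\<integral>\<^sup>+v. G b * indicator {v. v \<le> f t h} v + G (\<not> b) * indicator {v. \<not> v \<le> f t h} v \<partial>?U)"
      by (intro nn_integral_cong) auto
    also have "\<dots> = G b * ennreal (f t h) + G (\<not> b) * ennreal (1 - f t h)"
      using assms by (subst nn_integral_add) (auto simp: nn_integral_cmult_indicator emeasure_uniform_le simp del: emeasure_uniform_measure)
    finally show ?thesis by (simp add: mult.commute)
  qed
  note * = this[of "a t"]
  have sum: "(\<Sum>b\<in>UNIV. F b) = F (a t) + F (\<not> a t)" for F :: "bool \<Rightarrow> ennreal"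
    by (cases "a t") (simp_all add: UNIV_bool add.commute)
  show ?thesis
  proof (cases "n = a t")
    case True
    then show ?thesis
      using U.emeasure_space_1 by (simp add: sum flip_regime_def flip_prob_def)
  next
    case False
    then have "flip_regime a f t h n v = (if v \<le> f t h then a t else \<not> a t)" for v
      by (auto simp: flip_regime_def)
    with False * show ?thesis
      by (simp add: sum flip_prob_def)
  qed
qed

section \<open>Iterated integrals over treatment paths\<close>

lemma itint_cong:
  assumes "\<And>s. s \<in> {t..<t + k} \<Longrightarrow> \<kappa> s = \<kappa>' s" "\<And>s. s \<in> {t..<t + k} \<Longrightarrow> w s = w' s"
  shows "itint \<kappa> w g k t xs = itint \<kappa>' w' g k t xs"
  using assms
proof (induction k arbitrary: t xs)
  case (Suc k)
  have "itint \<kappa> w g k (Suc t) ys = itint \<kappa>' w' g k (Suc t) ys" for ys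
    using Suc.prems by (intro Suc.IH) auto
  moreover have "\<kappa> t = \<kappa>' t" "w t = w' t"
    using Suc.prems by auto
  ultimately show ?case by simp
qed simp

lemma itint_zero: "itint \<kappa> w (\<lambda>_. 0) k t xs = 0"
  by (induction k arbitrary: t xs) simp_all

lemma sum_PiE_insert:
  assumes "x \<notin> A"
  shows "(\<Sum>bs\<in>PiE (insert x A) (\<lambda>_. UNIV :: bool set). F bs)
    = (\<Sum>b\<in>UNIV. \<Sum>bs\<in>PiE A (\<lambda>_. UNIV). F (bs(x := b)))"
proof -
  have "inj_on (\<lambda>(y, g). g(x := y)) ((UNIV :: bool set) \<times> PiE A (\<lambda>_. UNIV))"
    using inj_combinator[OF assms, of "\<lambda>_. UNIV :: bool set"] by simp
  then show ?thesis
    unfolding PiE_insert_eq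
    by (subst sum.reindex) (simp_all add: sum.cartesian_product case_prod_beta comp_def)
qed

text \<open>With the last treatment as outcome, paths ending in \<open>False\<close> contribute 0,
  and those ending in \<open>True\<close> leave Q_t(1 | .) as the last factor.\<close>

lemma gformula_D_eq_gformula_Y:
  assumes "1 \<le> t"
  shows "gformula_D K pA f a t = gformula_Y K (\<lambda>p. of_bool (snd p t)) pA f a t"
proof -
  have t: "{1..t} = insert t {1..<t}"
    using assms by auto
  define I where "I bs = itint (\<lambda>s xs. K s (xs, restrict bs {1..<s}))
      (\<lambda>s xs. Qf pA f a s (bs s) (xs, restrict bs {1..<s})) (\<lambda>xs. of_bool (bs t)) t 1 (\<lambda>_. undefined)" for bs
  \<comment> \<open>Kernels and weights at time s read only treatments before s, so for s up to t
    they do not see the value of the path at t.\<close>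
  have res: "restrict (bs(t := b)) {1..<s} = restrict bs {1..<s}" if "s \<le> t" for bs s and b :: bool
    using that by (auto simp: fun_eq_iff)
  have "I (bs(t := True)) = itint (\<lambda>s xs. K s (xs, restrict bs {1..<s}))
      (\<lambda>s xs. if s = t then Qf pA f a t True (xs, bs) else Qf pA f a s (bs s) (xs, restrict bs {1..<s}))
      (\<lambda>_. 1) t 1 (\<lambda>_. undefined)" if "bs \<in> PiE {1..<t} (\<lambda>_. UNIV)" for bs
  proof -
    have "restrict bs {1..<t} = bs"
      using that by (auto simp: PiE_def extensional_restrict)
    then show ?thesis
      unfolding I_def by (simp add: res del: One_nat_def, intro itint_cong) (auto simp: res simp del: One_nat_def)
  qed
  moreover have "I (bs(t := False)) = 0" for bs
    by (simp add: I_def itint_zero)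
  ultimately have "gformula_D K pA f a t = (\<Sum>b\<in>UNIV. \<Sum>bs\<in>PiE {1..<t} (\<lambda>_. UNIV). I (bs(t := b)))"
    unfolding gformula_D_def by (simp add: UNIV_bool)
  also have "\<dots> = gformula_Y K (\<lambda>p. of_bool (snd p t)) pA f a t"
    unfolding gformula_Y_def t by (subst sum_PiE_insert) (simp_all add: I_def)
  finally show ?thesis .
qed

section \<open>Weighting by the ratio of treatment probabilities\<close>

text \<open>Recovers the history at time t from a longer past, so that \<open>weight\<close> can be
  a function of the past and not of the sample point.\<close>

definition subhist :: "nat \<Rightarrow> 'x hist \<Rightarrow> 'x hist" where
  "subhist t p = (restrict (fst p) {1..t}, restrict (snd p) {1..<t})"

lemma measurable_subhist:
  assumes "{1..t} \<subseteq> I" "{1..<t} \<subseteq> J"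
  shows "subhist t \<in> measurable (PiM I (\<lambda>_. borel) \<Otimes>\<^sub>M PiM J (\<lambda>_. count_space UNIV)) (HistM t)"
  unfolding subhist_def HistM_def using assms
  by (intro measurable_Pair) (auto intro!: measurable_compose[OF _ measurable_restrict_subset])

text \<open>These assumptions carry the reweighting identity; \<open>flip_kernel_model\<close> adds
  the covariate kernels in which the g-formula is expressed.\<close>

locale flip_model = prob_space M for M :: "'w measure" +
  fixes S :: "('w, 'x::topological_space, 'ux, 'ua, 'uy) scm"
    and UXM :: "nat \<Rightarrow> 'ux measure" and UAM :: "nat \<Rightarrow> 'ua measure" and UYM :: "'uy measure"
    and T :: nat
    and a :: "nat \<Rightarrow> bool"
    and f :: "nat \<Rightarrow> 'x hist \<Rightarrow> real"
    and pA :: "nat \<Rightarrow> 'x hist \<Rightarrow> real"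
  assumes fX_meas: "\<forall>t\<in>{1..T}. (\<lambda>(h, u). fX S t h u) \<in> measurable (PrevM t \<Otimes>\<^sub>M UXM t) borel"
    and fA_meas: "\<forall>t\<in>{1..T}. (\<lambda>(h, u). fA S t h u) \<in> measurable (HistM t \<Otimes>\<^sub>M UAM t) (count_space UNIV)"
    and UX_meas: "\<forall>t\<in>{1..T}. UX S t \<in> measurable M (UXM t)"
    and UA_meas: "\<forall>t\<in>{1..T}. UA S t \<in> measurable M (UAM t)"
    and UY_meas: "UY S \<in> measurable M UYM"
    and V_meas: "\<forall>t\<in>{1..T}. V S t \<in> borel_measurable M"
    and V_unif: "\<forall>t\<in>{1..T}. distr M borel (V S t) = uniform_measure lborel {0..1}"
    and V_indep: "prob_space.indep_vars M (\<lambda>_. borel) (V S) {1..T}"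
    and V_indep_U: "distr M ((PiM {1..T} UXM \<Otimes>\<^sub>M (PiM {1..T} UAM \<Otimes>\<^sub>M UYM)) \<Otimes>\<^sub>M PiM {1..T} (\<lambda>_. borel))
            (\<lambda>\<omega>. ((restrict (\<lambda>t. UX S t \<omega>) {1..T}, restrict (\<lambda>t. UA S t \<omega>) {1..T}, UY S \<omega>),
                   restrict (\<lambda>t. V S t \<omega>) {1..T}))
        = distr M (PiM {1..T} UXM \<Otimes>\<^sub>M (PiM {1..T} UAM \<Otimes>\<^sub>M UYM))
            (\<lambda>\<omega>. (restrict (\<lambda>t. UX S t \<omega>) {1..T}, restrict (\<lambda>t. UA S t \<omega>) {1..T}, UY S \<omega>))
          \<Otimes>\<^sub>M distr M (PiM {1..T} (\<lambda>_. borel)) (\<lambda>\<omega>. restrict (\<lambda>t. V S t \<omega>) {1..T})"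
    and seq_rand: "\<forall>t\<in>{1..T}. cond_indep M (obsH S t) (HistM t)
          (UA S t) (UAM t)
          (\<lambda>\<omega>. (restrict (\<lambda>s. UX S s \<omega>) {t<..T}, restrict (\<lambda>s. UA S s \<omega>) {t<..T}, UY S \<omega>))
          (PiM {t<..T} UXM \<Otimes>\<^sub>M (PiM {t<..T} UAM \<Otimes>\<^sub>M UYM))"
    and f_meas: "\<forall>t\<in>{1..T}. f t \<in> borel_measurable (HistM t)"
    and f_range: "\<forall>t\<in>{1..T}. \<forall>h\<in>space (HistM t). 0 \<le> f t h \<and> f t h \<le> 1"
    and pA_reg: "\<forall>t\<in>{1..T}. is_regression M (obsH S t) (HistM t) (\<lambda>\<omega>. of_bool (obsA S t \<omega>)) (pA t)"
    and positivity: "\<forall>t\<in>{1..T}.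
          measure M {\<omega>\<in>space M. pAt pA t (a t) (obsH S t \<omega>) = 0 \<longrightarrow> f t (obsH S t \<omega>) = 0} = 1
        \<or> measure M {\<omega>\<in>space M. pAt pA t (a t) (obsH S t \<omega>) = 0} = 0"
begin

lemma fX_compose:
  assumes "t \<in> {1..T}" "p \<in> measurable N (PrevM t)" "u \<in> measurable N (UXM t)"
  shows "(\<lambda>\<omega>. fX S t (p \<omega>) (u \<omega>)) \<in> borel_measurable N"
  using measurable_compose[OF measurable_Pair[OF assms(2,3)] fX_meas[rule_format, OF assms(1)]] by simp

lemma fA_compose:
  assumes "t \<in> {1..T}" "h \<in> measurable N (HistM t)" "u \<in> measurable N (UAM t)"
  shows "(\<lambda>\<omega>. fA S t (h \<omega>) (u \<omega>)) \<in> measurable N (count_space UNIV)"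
  using measurable_compose[OF measurable_Pair[OF assms(2,3)] fA_meas[rule_format, OF assms(1)]] by simp

lemma cf_past_flip_meas:
  assumes "n \<le> T"
  shows "cf_past S (flip_regime a f) n \<in> measurable M (PrevM (Suc n))"
  using assms fX_meas fA_meas UX_meas UA_meas V_meas f_meas
  by (intro cf_past_measurable[where UXM=UXM and UAM=UAM] flip_regime_measurable) auto

lemma obsPrev_meas:
  assumes "n \<le> T"
  shows "obsPrev S (Suc n) \<in> measurable M (PrevM (Suc n))"
proof -
  have "cf_past S natural_regime n \<in> measurable M (PrevM (Suc n))"
    using assms fX_meas fA_meas UX_meas UA_meas V_meas
    by (intro cf_past_measurable[where UXM=UXM and UAM=UAM] natural_regime_measurable) auto
  then show ?thesis
    by (simp add: obsPrev_eq_cf_past cong: measurable_cong)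
qed

lemma obsX_meas:
  assumes "t \<in> {1..T}"
  shows "obsX S t \<in> borel_measurable M"
proof -
  obtain n where [simp]: "t = Suc n" using assms by (cases t) auto
  have "(\<lambda>\<omega>. fX S (Suc n) (obsPrev S (Suc n) \<omega>) (UX S (Suc n) \<omega>)) \<in> borel_measurable M"
    using assms UX_meas by (intro fX_compose obsPrev_meas) auto
  then show ?thesis
    by (simp add: obsX_eq cong: measurable_cong)
qed

lemma obsH_meas:
  assumes "t \<in> {1..T}"
  shows "obsH S t \<in> measurable M (HistM t)"
proof -
  obtain n where [simp]: "t = Suc n" using assms by (cases t) auto
  have "(\<lambda>\<omega>. add_cov (Suc n) (obsPrev S (Suc n) \<omega>) (obsX S (Suc n) \<omega>)) \<in> measurable M (HistM (Suc n))"
    using assms by (intro measurable_add_cov obsPrev_meas obsX_meas) auto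
  then show ?thesis
    unfolding \<open>t = Suc n\<close> by (rule measurable_cong[THEN iffD1, rotated]) (simp add: obsH_Suc)
qed

lemma obsA_meas:
  assumes "t \<in> {1..T}"
  shows "obsA S t \<in> measurable M (count_space UNIV)"
proof -
  have "(\<lambda>\<omega>. fA S t (obsH S t \<omega>) (UA S t \<omega>)) \<in> measurable M (count_space UNIV)"
    using assms UA_meas by (intro fA_compose obsH_meas) auto
  then show ?thesis
    using assms by (simp add: obsA_eq cong: measurable_cong)
qed

lemma pA_meas [measurable (raw)]: "t \<in> {1..T} \<Longrightarrow> pA t \<in> borel_measurable (HistM t)"
  using pA_reg by (auto simp: is_regression_def)

lemma f_meas' [measurable (raw)]: "t \<in> {1..T} \<Longrightarrow> f t \<in> borel_measurable (HistM t)"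
  using f_meas by auto

lemma pAt_meas: "t \<in> {1..T} \<Longrightarrow> pAt pA t b \<in> borel_measurable (HistM t)"
  unfolding pAt_def by (cases b) simp_all

lemma Qf_meas: "t \<in> {1..T} \<Longrightarrow> Qf pA f a t b \<in> borel_measurable (HistM t)"
  using pAt_meas[of t "a t"] unfolding Qf_def Let_def by (cases "b = a t") simp_all

text \<open>A vanishing denominator gives the value 0. By \<open>AE_prob_bounds\<close> Q then
  vanishes as well, so P * ratio = Q holds almost surely along observed histories.\<close>

definition ratio :: "nat \<Rightarrow> 'x hist \<Rightarrow> bool \<Rightarrow> real" where
  "ratio t h b = Qf pA f a t b h / pAt pA t b h"

definition weight :: "nat \<Rightarrow> 'x hist \<Rightarrow> real" where
  "weight k p = (\<Prod>t\<in>{1..k}. ratio t (subhist t p) (snd p t))"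

lemma ratio_meas: "t \<in> {1..T} \<Longrightarrow> (\<lambda>h. ratio t h b) \<in> borel_measurable (HistM t)"
  using Qf_meas[of t b] pAt_meas[of t b] unfolding ratio_def by simp

lemma weight_measurable:
  assumes "k \<le> T" "{1..k} \<subseteq> I" "{1..k} \<subseteq> J"
  shows "weight k \<in> borel_measurable (PiM I (\<lambda>_. borel) \<Otimes>\<^sub>M PiM J (\<lambda>_. count_space UNIV))" (is "_ \<in> borel_measurable ?N")
  unfolding weight_def
proof (rule borel_measurable_prod)
  fix t assume t: "t \<in> {1..k}"
  have b: "(\<lambda>p. snd p t) \<in> measurable ?N (count_space UNIV)"
    using t assms by (intro measurable_compose[OF measurable_snd measurable_component_singleton]) auto
  have h: "subhist t \<in> measurable ?N (HistM t)"
    using t assms by (intro measurable_subhist) auto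
  have "(\<lambda>p. if snd p t then ratio t (subhist t p) True else ratio t (subhist t p) False) \<in> borel_measurable ?N"
    using t assms b by (intro measurable_If measurable_compose[OF h ratio_meas]) auto
  then show "(\<lambda>p. ratio t (subhist t p) (snd p t)) \<in> borel_measurable ?N"
    by (rule measurable_cong[THEN iffD1, rotated]) (auto split: if_splits)
qed

lemma weight_meas_Prev: "k \<le> T \<Longrightarrow> weight k \<in> borel_measurable (PrevM (Suc k))"
  unfolding PrevM_def by (rule weight_measurable) auto

lemma weight_meas_Hist: "k \<le> T \<Longrightarrow> weight k \<in> borel_measurable (HistM (Suc k))"
  unfolding HistM_def by (rule weight_measurable) auto

lemma subhist_obsPrev: "t \<le> k \<Longrightarrow> subhist t (obsPrev S (Suc k) \<omega>) = obsH S t \<omega>"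
  by (auto simp: subhist_def obsPrev_def obsH_def fun_eq_iff)

lemma weight_add_cov: "weight k (add_cov (Suc k) p x) = weight k p"
  unfolding weight_def
  by (intro prod.cong refl arg_cong2[where f="ratio _"])
    (auto simp: subhist_def add_cov_def fun_eq_iff)

lemma weight_obsH: "weight k (obsH S (Suc k) \<omega>) = weight k (obsPrev S (Suc k) \<omega>)"
  by (simp add: obsH_Suc weight_add_cov)

lemma weight_obsPrev:
  "weight k (obsPrev S (Suc k) \<omega>) = (\<Prod>t\<in>{1..k}. ratio t (obsH S t \<omega>) (obsA S t \<omega>))"
  unfolding weight_def
  by (intro prod.cong refl arg_cong2[where f="ratio _"]) (simp_all add: subhist_obsPrev, simp add: obsPrev_def)

lemma weight_obsPrev_Suc:
  "weight (Suc k) (obsPrev S (Suc (Suc k)) \<omega>)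
    = weight k (obsH S (Suc k) \<omega>) * ratio (Suc k) (obsH S (Suc k) \<omega>) (obsA S (Suc k) \<omega>)"
  unfolding weight_obsPrev weight_obsH by simp

text \<open>Let p be the probability of the target. If p = 0, then Q of the target is f, which the
  positivity condition makes 0. For the other value probability 0 means p = 1, whence Q of the
  target is 1 and Q of the other value is 0.\<close>

lemma AE_prob_bounds:
  assumes t: "t \<in> {1..T}"
  shows "AE \<omega> in M. \<forall>b. 0 \<le> pAt pA t b (obsH S t \<omega>) \<and> 0 \<le> Qf pA f a t b (obsH S t \<omega>) \<and>
    (pAt pA t b (obsH S t \<omega>) = 0 \<longrightarrow> Qf pA f a t b (obsH S t \<omega>) = 0)"
proof -
  note [measurable] = obsH_meas[OF t] obsA_meas[OF t] f_meas'[OF t] pAt_meas[OF t]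
  have 1: "AE \<omega> in M. 0 \<le> pA t (obsH S t \<omega>) \<and> pA t (obsH S t \<omega>) \<le> 1"
    by (rule regression_bounds[OF prob_space_axioms obsH_meas[OF t] pA_reg[rule_format, OF t]]) auto
  \<comment> \<open>Both alternatives lead to this one statement, under the second because its
    premise almost surely fails.\<close>
  have 2: "AE \<omega> in M. pAt pA t (a t) (obsH S t \<omega>) = 0 \<longrightarrow> f t (obsH S t \<omega>) = 0"
    using positivity[rule_format, OF t]
  proof
    assume "prob {\<omega> \<in> space M. pAt pA t (a t) (obsH S t \<omega>) = 0 \<longrightarrow> f t (obsH S t \<omega>) = 0} = 1"
    then show ?thesis
      by (subst (asm) prob_Collect_eq_1) auto
  next
    assume "prob {\<omega> \<in> space M. pAt pA t (a t) (obsH S t \<omega>) = 0} = 0"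
    then have "AE \<omega> in M. pAt pA t (a t) (obsH S t \<omega>) \<noteq> 0"
      by (subst (asm) prob_Collect_eq_0) auto
    then show ?thesis by auto
  qed
  show ?thesis
    using 1 2 AE_space
  proof eventually_elim
    case (elim \<omega>)
    then have fr: "0 \<le> f t (obsH S t \<omega>)" "f t (obsH S t \<omega>) \<le> 1"
      using f_range t measurable_space[OF obsH_meas[OF t]] by auto
    have p: "0 \<le> pAt pA t b (obsH S t \<omega>)" for b
      using elim by (auto simp: pAt_def)
    have "0 \<le> flip_prob a f t (obsH S t \<omega>) n b" for n b
      using fr by (auto simp: flip_prob_def)
    then have "0 \<le> Qf pA f a t b (obsH S t \<omega>)" for b
      unfolding Qf_eq_sum_flip_prob using p by (auto intro!: sum_nonneg)
    moreover have "Qf pA f a t b (obsH S t \<omega>) = 0" if "pAt pA t b (obsH S t \<omega>) = 0" for b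
      using that elim by (cases b; cases "a t") (auto simp: Qf_def pAt_def Let_def)
    ultimately show ?case
      using p by auto
  qed
qed

lemma AE_weight_nonneg:
  assumes "k \<le> T"
  shows "AE \<omega> in M. 0 \<le> weight k (obsPrev S (Suc k) \<omega>)"
proof -
  have "AE \<omega> in M. \<forall>t\<in>{1..k}. \<forall>b. 0 \<le> pAt pA t b (obsH S t \<omega>) \<and> 0 \<le> Qf pA f a t b (obsH S t \<omega>) \<and>
    (pAt pA t b (obsH S t \<omega>) = 0 \<longrightarrow> Qf pA f a t b (obsH S t \<omega>) = 0)"
    using assms by (intro AE_finite_allI AE_prob_bounds) auto
  then show ?thesis
    by eventually_elim (auto simp: weight_obsPrev ratio_def intro!: prod_nonneg divide_nonneg_nonneg)
qed

section \<open>Counterfactual side: integrating out the uniform variables\<close>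

definition exog :: "'w \<Rightarrow> (nat \<Rightarrow> 'ux) \<times> (nat \<Rightarrow> 'ua) \<times> 'uy" where
  "exog \<omega> = (restrict (\<lambda>t. UX S t \<omega>) {1..T}, restrict (\<lambda>t. UA S t \<omega>) {1..T}, UY S \<omega>)"

definition ExoM :: "nat set \<Rightarrow> ((nat \<Rightarrow> 'ux) \<times> (nat \<Rightarrow> 'ua) \<times> 'uy) measure" where
  "ExoM I = PiM I UXM \<Otimes>\<^sub>M (PiM I UAM \<Otimes>\<^sub>M UYM)"

lemma exog_meas: "exog \<in> measurable M (ExoM {1..T})"
  unfolding exog_def ExoM_def using UX_meas UA_meas UY_meas
  by (intro measurable_Pair measurable_restrict) auto

lemma ExoM_UX: "t \<in> I \<Longrightarrow> (\<lambda>u. fst u t) \<in> measurable (ExoM I) (UXM t)"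
  unfolding ExoM_def by measurable

lemma ExoM_UA: "t \<in> I \<Longrightarrow> (\<lambda>u. fst (snd u) t) \<in> measurable (ExoM I) (UAM t)"
  unfolding ExoM_def by measurable

lemma ExoM_UY: "(\<lambda>u. snd (snd u)) \<in> measurable (ExoM I) UYM"
  unfolding ExoM_def by measurable

text \<open>Expected outcome when the past \<open>p\<close> up to time \<open>k\<close> is followed by \<open>j\<close> flip steps
  driven by the exogenous values \<open>u\<close>, with the uniform variables integrated out.\<close>

primrec future :: "('x hist \<Rightarrow> 'uy \<Rightarrow> ennreal) \<Rightarrow> nat \<Rightarrow> nat \<Rightarrow> 'x hist
    \<Rightarrow> (nat \<Rightarrow> 'ux) \<times> (nat \<Rightarrow> 'ua) \<times> 'uy \<Rightarrow> ennreal" where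
  "future phi 0 k p u = phi p (snd (snd u))"
| "future phi (Suc j) k p u =
     (let h = add_cov (Suc k) p (fX S (Suc k) p (fst u (Suc k)))
      in \<Sum>b\<in>UNIV. ennreal (flip_prob a f (Suc k) h (fA S (Suc k) h (fst (snd u) (Suc k))) b)
           * future phi j (Suc k) (add_trt (Suc k) h b) u)"

text \<open>The j steps after time k read exogenous variables at times k + 1 to k + j only. Hence
  after treatment t the vector \<open>exog\<close> may be replaced by the variables later than t, to
  which sequential randomization refers.\<close>

lemma future_cong:
  assumes "\<And>t. t \<in> {k<..k + j} \<Longrightarrow> fst u t = fst u' t"
    and "\<And>t. t \<in> {k<..k + j} \<Longrightarrow> fst (snd u) t = fst (snd u') t"
    and "snd (snd u) = snd (snd u')"
  shows "future phi j k p u = future phi j k p u'"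
  using assms
proof (induction j arbitrary: k p)
  case (Suc j)
  have "fst u (Suc k) = fst u' (Suc k)" "fst (snd u) (Suc k) = fst (snd u') (Suc k)"
    using Suc.prems by auto
  moreover have "future phi j (Suc k) q u = future phi j (Suc k) q u'" for q
    using Suc.prems by (intro Suc.IH) auto
  ultimately show ?case
    by simp
qed simp

lemma future_measurable:
  assumes "k + j \<le> T" "{k<..k + j} \<subseteq> I"
    and phi: "(\<lambda>(p, y). phi p y) \<in> borel_measurable (PrevM (Suc (k + j)) \<Otimes>\<^sub>M UYM)"
    and "p \<in> measurable N (PrevM (Suc k))" "u \<in> measurable N (ExoM I)"
  shows "(\<lambda>\<omega>. future phi j k (p \<omega>) (u \<omega>)) \<in> borel_measurable N"
  using assms
proof (induction j arbitrary: k p)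
  case 0
  then have "(\<lambda>\<omega>. (p \<omega>, snd (snd (u \<omega>)))) \<in> measurable N (PrevM (Suc k) \<Otimes>\<^sub>M UYM)"
    by (intro measurable_Pair measurable_compose[OF _ ExoM_UY]) auto
  from measurable_compose[OF this 0(3)[simplified]] show ?case
    by simp
next
  case (Suc j)
  let ?h = "\<lambda>\<omega>. add_cov (Suc k) (p \<omega>) (fX S (Suc k) (p \<omega>) (fst (u \<omega>) (Suc k)))"
  have x: "(\<lambda>\<omega>. fst (u \<omega>) (Suc k)) \<in> measurable N (UXM (Suc k))"
    "(\<lambda>\<omega>. fst (snd (u \<omega>)) (Suc k)) \<in> measurable N (UAM (Suc k))"
    using Suc.prems by (auto intro!: measurable_compose[OF _ ExoM_UX] measurable_compose[OF _ ExoM_UA])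
  have h: "?h \<in> measurable N (HistM (Suc k))"
    using Suc.prems x by (intro measurable_add_cov fX_compose) auto
  have n: "(\<lambda>\<omega>. fA S (Suc k) (?h \<omega>) (fst (snd (u \<omega>)) (Suc k))) \<in> measurable N (count_space UNIV)"
    using Suc.prems h x by (intro fA_compose) auto
  have "(\<lambda>\<omega>. future phi j (Suc k) (add_trt (Suc k) (?h \<omega>) b) (u \<omega>)) \<in> borel_measurable N" for b
    using Suc.prems h by (intro Suc.IH measurable_add_trt) auto
  moreover have "(\<lambda>\<omega>. flip_prob a f (Suc k) (?h \<omega>) (fA S (Suc k) (?h \<omega>) (fst (snd (u \<omega>)) (Suc k))) b)
      \<in> borel_measurable N" for b
    using Suc.prems by (intro flip_prob_measurable[OF _ h n] f_meas') auto
  ultimately show ?case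
    by (simp add: Let_def)
qed

text \<open>The next uniform variable is independent of the exogenous variables and the earlier
  uniforms jointly. The assumptions give this in two pieces, so the proof separates the exogenous
  variables from all uniforms, then the last uniform from the earlier ones, inserts the uniform law,
  and undoes the first separation.\<close>

lemma V_fresh:
  assumes k: "k < T"
    and F[measurable]: "F \<in> borel_measurable ((ExoM {1..T} \<Otimes>\<^sub>M PiM {1..k} (\<lambda>_. borel)) \<Otimes>\<^sub>M borel)"
  shows "(\<integral>\<^sup>+\<omega>. F ((exog \<omega>, restrict (\<lambda>t. V S t \<omega>) {1..k}), V S (Suc k) \<omega>) \<partial>M)
    = (\<integral>\<^sup>+\<omega>. (\<integral>\<^sup>+v. F ((exog \<omega>, restrict (\<lambda>t. V S t \<omega>) {1..k}), v) \<partial>uniform_measure lborel {0..1}) \<partial>M)"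
proof -
  let ?U = "uniform_measure lborel {0..1::real}"
  define Vk where "Vk = (\<lambda>\<omega>. restrict (\<lambda>t. V S t \<omega>) {1..k})"
  define VT where "VT = (\<lambda>\<omega>. restrict (\<lambda>t. V S t \<omega>) {1..T})"
  interpret U: prob_space ?U
    by (rule prob_space_uniform_measure) auto
  note [measurable] = exog_meas
  have VkM[measurable]: "Vk \<in> measurable M (PiM {1..k} (\<lambda>_. borel))" and VTM[measurable]: "VT \<in> measurable M (PiM {1..T} (\<lambda>_. borel))"
    and [measurable]: "V S (Suc k) \<in> borel_measurable M"
    unfolding Vk_def VT_def using V_meas k by (auto intro!: measurable_restrict)
  have [measurable]: "(\<lambda>v. restrict v {1..k}) \<in> measurable (PiM {1..T} (\<lambda>_. borel)) (PiM {1..k} (\<lambda>_. borel :: real measure))"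
    "(\<lambda>v. v (Suc k)) \<in> measurable (PiM {1..T} (\<lambda>_. borel :: real measure)) borel"
    using k by (auto intro!: measurable_restrict_subset measurable_component_singleton)
  have V1M: "(\<lambda>\<omega>. restrict (\<lambda>t. V S t \<omega>) {Suc k}) \<in> measurable M (PiM {Suc k} (\<lambda>_. borel))"
    by (intro measurable_restrict) auto
  have VT: "restrict (VT \<omega>) {1..k} = Vk \<omega>" "VT \<omega> (Suc k) = V S (Suc k) \<omega>" for \<omega>
    using k by (auto simp: VT_def Vk_def fun_eq_iff)
  have prod1: "distr M (ExoM {1..T} \<Otimes>\<^sub>M PiM {1..T} (\<lambda>_. borel)) (\<lambda>\<omega>. (exog \<omega>, VT \<omega>))
      = distr M (ExoM {1..T}) exog \<Otimes>\<^sub>M distr M (PiM {1..T} (\<lambda>_. borel)) VT"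
    unfolding ExoM_def exog_def VT_def by (rule V_indep_U)
  \<comment> \<open>Mutual independence is used for the blocks {1..k} and {Suc k}; the second is a
    family with one member, read off afterwards at \<open>Suc k\<close>.\<close>
  have "indep_var (PiM {1..k} (\<lambda>_. borel)) Vk (PiM {Suc k} (\<lambda>_. borel)) (\<lambda>\<omega>. restrict (\<lambda>t. V S t \<omega>) {Suc k})"
    unfolding Vk_def using V_indep k by (intro indep_var_restrict[where I="{1..T}"]) auto
  then have prod2: "distr M (PiM {1..k} (\<lambda>_. borel) \<Otimes>\<^sub>M PiM {Suc k} (\<lambda>_. borel))
        (\<lambda>\<omega>. (Vk \<omega>, restrict (\<lambda>t. V S t \<omega>) {Suc k}))
      = distr M (PiM {1..k} (\<lambda>_. borel)) Vk \<Otimes>\<^sub>M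
        distr M (PiM {Suc k} (\<lambda>_. borel)) (\<lambda>\<omega>. restrict (\<lambda>t. V S t \<omega>) {Suc k})"
    by (simp add: indep_var_distribution_eq)
  have u: "(\<integral>\<^sup>+\<omega>. g (V S (Suc k) \<omega>) \<partial>M) = (\<integral>\<^sup>+v. g v \<partial>?U)" if "g \<in> borel_measurable borel" for g :: "real \<Rightarrow> ennreal"
  proof -
    have "distr M borel (V S (Suc k)) = ?U"
      using V_unif k by auto
    moreover have "(\<integral>\<^sup>+v. g v \<partial>distr M borel (V S (Suc k))) = (\<integral>\<^sup>+\<omega>. g (V S (Suc k) \<omega>) \<partial>M)"
      using that by (intro nn_integral_distr) auto
    ultimately show ?thesis
      by simp
  qed
  have [measurable]: "(\<lambda>e. \<integral>\<^sup>+v. F (e, v) \<partial>?U) \<in> borel_measurable (ExoM {1..T} \<Otimes>\<^sub>M PiM {1..k} (\<lambda>_. borel))"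
  proof (rule U.borel_measurable_nn_integral)
    have "sets ((ExoM {1..T} \<Otimes>\<^sub>M PiM {1..k} (\<lambda>_. borel :: real measure)) \<Otimes>\<^sub>M ?U)
        = sets ((ExoM {1..T} \<Otimes>\<^sub>M PiM {1..k} (\<lambda>_. borel)) \<Otimes>\<^sub>M borel)"
      by (intro sets_pair_measure_cong) auto
    from measurable_cong_sets[OF this refl] F
    show "(\<lambda>(e, v). F (e, v)) \<in> borel_measurable ((ExoM {1..T} \<Otimes>\<^sub>M PiM {1..k} (\<lambda>_. borel)) \<Otimes>\<^sub>M ?U)"
      by simp
  qed
  have "(\<integral>\<^sup>+\<omega>. F ((exog \<omega>, Vk \<omega>), V S (Suc k) \<omega>) \<partial>M)
      = (\<integral>\<^sup>+\<omega>. (\<integral>\<^sup>+\<omega>'. F ((exog \<omega>, Vk \<omega>'), V S (Suc k) \<omega>') \<partial>M) \<partial>M)"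
    using nn_integral_distr_prod[OF prob_space_axioms exog_meas VTM prod1,
        of "\<lambda>(u, v). F ((u, restrict v {1..k}), v (Suc k))"] by (simp add: VT del: One_nat_def)
  also have "\<dots> = (\<integral>\<^sup>+\<omega>. (\<integral>\<^sup>+\<omega>'. (\<integral>\<^sup>+\<omega>''. F ((exog \<omega>, Vk \<omega>'), V S (Suc k) \<omega>'') \<partial>M) \<partial>M) \<partial>M)"
  proof (rule nn_integral_cong)
    fix \<omega> assume "\<omega> \<in> space M"
    then have [measurable]: "exog \<omega> \<in> space (ExoM {1..T})"
      using measurable_space[OF exog_meas] by auto
    show "(\<integral>\<^sup>+\<omega>'. F ((exog \<omega>, Vk \<omega>'), V S (Suc k) \<omega>') \<partial>M)
        = (\<integral>\<^sup>+\<omega>'. (\<integral>\<^sup>+\<omega>''. F ((exog \<omega>, Vk \<omega>'), V S (Suc k) \<omega>'') \<partial>M) \<partial>M)"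
      using nn_integral_distr_prod[OF prob_space_axioms VkM V1M prod2,
        of "\<lambda>(v, w). F ((exog \<omega>, v), w (Suc k))"]
      by (simp del: One_nat_def)
  qed
  also have "\<dots> = (\<integral>\<^sup>+\<omega>. (\<integral>\<^sup>+\<omega>'. (\<integral>\<^sup>+v. F ((exog \<omega>, Vk \<omega>'), v) \<partial>?U) \<partial>M) \<partial>M)"
  proof (intro nn_integral_cong u)
    fix \<omega> \<omega>' assume "\<omega> \<in> space M" "\<omega>' \<in> space M"
    then have "(exog \<omega>, Vk \<omega>') \<in> space (ExoM {1..T} \<Otimes>\<^sub>M PiM {1..k} (\<lambda>_. borel))"
      using measurable_space[OF exog_meas] measurable_space[OF VkM]
      by (auto simp: space_pair_measure)
    then show "(\<lambda>v. F ((exog \<omega>, Vk \<omega>'), v)) \<in> borel_measurable borel"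
      by measurable
  qed
  \<comment> \<open>With the last uniform integrated out, what remains depends on the exogenous
    variables and the earlier uniforms, and the product structure is used in the reverse direction
    to put both at the same sample point.\<close>
  also have "\<dots> = (\<integral>\<^sup>+\<omega>. (\<integral>\<^sup>+v. F ((exog \<omega>, Vk \<omega>), v) \<partial>?U) \<partial>M)"
    using nn_integral_distr_prod[OF prob_space_axioms exog_meas VTM prod1,
        of "\<lambda>(u, v). \<integral>\<^sup>+w. F ((u, restrict v {1..k}), w) \<partial>?U"] by (simp add: VT del: One_nat_def)
  finally show ?thesis
    by (simp add: Vk_def)
qed

text \<open>Read from right to left: of the actual step at time k + 1 only the decision uses
  \<open>V S (Suc k)\<close>. Averaging over that variable by \<open>V_fresh\<close> produces the
  \<open>flip_prob\<close> weights of one more step of \<open>future\<close>.\<close>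

lemma future_step_flip:
  assumes k: "k + Suc j \<le> T"
    and phi: "(\<lambda>(p, y). phi p y) \<in> borel_measurable (PrevM (Suc (k + Suc j)) \<Otimes>\<^sub>M UYM)"
  shows "(\<integral>\<^sup>+\<omega>. future phi (Suc j) k (cf_past S (flip_regime a f) k \<omega>) (exog \<omega>) \<partial>M)
    = (\<integral>\<^sup>+\<omega>. future phi j (Suc k) (cf_past S (flip_regime a f) (Suc k) \<omega>) (exog \<omega>) \<partial>M)"
proof -
  let ?E = "ExoM {1..T} \<Otimes>\<^sub>M PiM {1..k} (\<lambda>_. borel :: real measure)"
  let ?g = "flip_regime a f"
  let ?Vk = "\<lambda>\<omega>. restrict (\<lambda>t. V S t \<omega>) {1..k}"
  \<comment> \<open>Running the model on the canonical space exhibits the counterfactual past as a measurable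
      function of the exogenous variables and of the uniform variables used so far.\<close>
  define S' :: "(((nat \<Rightarrow> 'ux) \<times> (nat \<Rightarrow> 'ua) \<times> 'uy) \<times> (nat \<Rightarrow> real), 'x, 'ux, 'ua, 'uy) scm" where
    "S' = \<lparr>fX = fX S, fA = fA S, fY = fY S, UX = \<lambda>t e. fst (fst e) t, UA = \<lambda>t e. fst (snd (fst e)) t,
      UY = \<lambda>e. snd (snd (fst e)), V = \<lambda>t e. snd e t\<rparr>"
  define P where "P = cf_past S' ?g k"
  have P_eq: "cf_past S ?g k \<omega> = P (exog \<omega>, ?Vk \<omega>)" for \<omega>
    unfolding P_def using k by (intro cf_past_cong) (auto simp: S'_def exog_def)
  have P[measurable]: "P \<in> measurable ?E (PrevM (Suc k))"
    unfolding P_def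
  proof (rule cf_past_measurable[where UXM=UXM and UAM=UAM])
    fix t assume t: "t \<in> {1..k}"
    show "UX S' t \<in> measurable ?E (UXM t)" "UA S' t \<in> measurable ?E (UAM t)"
      using t k by (auto simp: S'_def intro!: measurable_compose[OF _ ExoM_UX] measurable_compose[OF _ ExoM_UA])
    show "V S' t \<in> borel_measurable ?E"
      using t by (auto simp: S'_def intro!: measurable_compose[OF measurable_snd measurable_component_singleton])
  qed (use k fX_meas fA_meas f_meas in \<open>auto simp: S'_def intro!: flip_regime_measurable\<close>)
  \<comment> \<open>\<open>h\<close> and \<open>n\<close> are the history and the natural treatment
    at time k + 1 as functions of the exogenous values and the first k uniforms; in \<open>d\<close>
    the fresh uniform enters as a separate argument.\<close>
  define h where "h e = add_cov (Suc k) (P e) (fX S (Suc k) (P e) (fst (fst e) (Suc k)))" for e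
  define n where "n e = fA S (Suc k) (h e) (fst (snd (fst e)) (Suc k))" for e
  have x: "(\<lambda>e. fst (fst e) (Suc k)) \<in> measurable ?E (UXM (Suc k))"
    "(\<lambda>e. fst (snd (fst e)) (Suc k)) \<in> measurable ?E (UAM (Suc k))"
    using k by (auto intro!: measurable_compose[OF _ ExoM_UX] measurable_compose[OF _ ExoM_UA])
  have h: "h \<in> measurable ?E (HistM (Suc k))"
    unfolding h_def using k x by (intro measurable_add_cov fX_compose P) auto
  have n: "n \<in> measurable ?E (count_space UNIV)"
    unfolding n_def using k x h by (intro fA_compose) auto
  define d where "d = (\<lambda>(e, v). ?g (Suc k) (h e) (n e) v)"
  have d: "d \<in> measurable (?E \<Otimes>\<^sub>M borel) (count_space UNIV)"
  proof -
    have "(\<lambda>q. (h (fst q), n (fst q), snd q)) \<in> measurable (?E \<Otimes>\<^sub>M borel) (HistM (Suc k) \<Otimes>\<^sub>M count_space UNIV \<Otimes>\<^sub>M borel)"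
      using h n by measurable
    from measurable_compose[OF this flip_regime_measurable[where t="Suc k" and f=f and a=a]] f_meas k show ?thesis
      by (simp add: d_def case_prod_beta)
  qed
  define F where "F = (\<lambda>q. future phi j (Suc k) (add_trt (Suc k) (h (fst q)) (d q)) (fst (fst q)))"
  have F: "F \<in> borel_measurable (?E \<Otimes>\<^sub>M borel)"
    unfolding F_def using k phi
    by (intro future_measurable[where I="{1..T}"] measurable_add_trt d measurable_compose[OF measurable_fst h])
      auto
  have "(\<integral>\<^sup>+\<omega>. future phi j (Suc k) (cf_past S ?g (Suc k) \<omega>) (exog \<omega>) \<partial>M)
      = (\<integral>\<^sup>+\<omega>. F ((exog \<omega>, ?Vk \<omega>), V S (Suc k) \<omega>) \<partial>M)"
    using k by (intro nn_integral_cong) (simp add: F_def d_def h_def n_def P_eq Let_def, simp add: exog_def)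
  also have "\<dots> = (\<integral>\<^sup>+\<omega>. (\<integral>\<^sup>+v. F ((exog \<omega>, ?Vk \<omega>), v) \<partial>uniform_measure lborel {0..1}) \<partial>M)"
    using k by (intro V_fresh F) auto
  also have "\<dots> = (\<integral>\<^sup>+\<omega>. future phi (Suc j) k (cf_past S ?g k \<omega>) (exog \<omega>) \<partial>M)"
  proof (intro nn_integral_cong)
    fix \<omega> assume w: "\<omega> \<in> space M"
    let ?e = "(exog \<omega>, ?Vk \<omega>)"
    have "?e \<in> space ?E"
      using w measurable_space[OF exog_meas w] by (auto simp: space_pair_measure space_PiM)
    then have "h ?e \<in> space (HistM (Suc k))"
      by (rule measurable_space[OF h])
    then have fr: "0 \<le> f (Suc k) (h ?e)" "f (Suc k) (h ?e) \<le> 1"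
      using f_range k by auto
    show "(\<integral>\<^sup>+v. F (?e, v) \<partial>uniform_measure lborel {0..1}) = future phi (Suc j) k (cf_past S ?g k \<omega>) (exog \<omega>)"
      using nn_integral_flip_regime[where f=f and t="Suc k" and a=a, OF fr,
          of "\<lambda>b. future phi j (Suc k) (add_trt (Suc k) (h ?e) b) (exog \<omega>)" "n ?e"]
      by (simp add: F_def d_def P_eq Let_def h_def n_def)
  qed
  finally show ?thesis ..
qed

lemma future_flip:
  assumes "k + j \<le> T"
    and "(\<lambda>(p, y). phi p y) \<in> borel_measurable (PrevM (Suc (k + j)) \<Otimes>\<^sub>M UYM)"
  shows "(\<integral>\<^sup>+\<omega>. future phi j k (cf_past S (flip_regime a f) k \<omega>) (exog \<omega>) \<partial>M)
    = (\<integral>\<^sup>+\<omega>. phi (cf_past S (flip_regime a f) (k + j) \<omega>) (UY S \<omega>) \<partial>M)"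
  using assms
proof (induction j arbitrary: k)
  case 0
  then show ?case by (simp add: exog_def)
next
  case (Suc j)
  then show ?case
    using Suc.IH[of "Suc k"] future_step_flip[of k j phi] by simp
qed

section \<open>Observational side: sequential randomization and reweighting\<close>

definition later :: "nat \<Rightarrow> 'w \<Rightarrow> (nat \<Rightarrow> 'ux) \<times> (nat \<Rightarrow> 'ua) \<times> 'uy" where
  "later t \<omega> = (restrict (\<lambda>s. UX S s \<omega>) {t<..T}, restrict (\<lambda>s. UA S s \<omega>) {t<..T}, UY S \<omega>)"

lemma later_meas: "later t \<in> measurable M (ExoM {t<..T})"
  unfolding later_def ExoM_def using UX_meas UA_meas UY_meas
  by (intro measurable_Pair measurable_restrict) auto

lemma regression_obsA:
  assumes t: "t \<in> {1..T}"
  shows "is_regression M (obsH S t) (HistM t) (\<lambda>\<omega>. of_bool (obsA S t \<omega> = n)) (pAt pA t n)"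
proof -
  note [measurable] = obsA_meas[OF t] obsH_meas[OF t]
  have int: "integrable M (\<lambda>\<omega>. of_bool (obsA S t \<omega>) :: real)"
    by (intro integrable_const_bound[of _ 1]) auto
  have "(\<lambda>\<omega>. of_bool (obsA S t \<omega> = n) :: real)
      = (if n then (\<lambda>\<omega>. of_bool (obsA S t \<omega>)) else (\<lambda>\<omega>. 1 - of_bool (obsA S t \<omega>)))"
    by (auto simp: fun_eq_iff)
  then show ?thesis
    using is_regression_one_minus[OF prob_space_axioms obsH_meas[OF t] int pA_reg[rule_format, OF t]]
      pA_reg t unfolding pAt_def[abs_def] by auto
qed

text \<open>The event that the treatment equals \<open>n\<close> is a set \<open>E\<close> of pairs
  (history, \<open>UA S t\<close>) through \<open>fA\<close>, and \<open>pAt pA t n\<close> is a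
  regression of its indicator, so \<open>cond_indep_nn_integral\<close> applies.\<close>

lemma seq_rand_nn_integral:
  assumes t: "t \<in> {1..T}"
    and G: "(\<lambda>(h, u). G h u) \<in> borel_measurable (HistM t \<Otimes>\<^sub>M ExoM {t<..T})"
  shows "(\<integral>\<^sup>+\<omega>. of_bool (obsA S t \<omega> = n) * G (obsH S t \<omega>) (later t \<omega>) \<partial>M)
    = (\<integral>\<^sup>+\<omega>. ennreal (pAt pA t n (obsH S t \<omega>)) * G (obsH S t \<omega>) (later t \<omega>) \<partial>M)"
proof -
  note [measurable] = obsA_meas[OF t] obsH_meas[OF t] later_meas[of t] UA_meas[rule_format, OF t]
    fA_meas[rule_format, OF t]
  define E where "E = {q \<in> space (HistM t \<Otimes>\<^sub>M UAM t). (case q of (h, u) \<Rightarrow> fA S t h u) = n}"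
  have [measurable]: "E \<in> sets (HistM t \<Otimes>\<^sub>M UAM t)"
    unfolding E_def by measurable
  have E: "(obsH S t \<omega>, UA S t \<omega>) \<in> E \<longleftrightarrow> obsA S t \<omega> = n" if "\<omega> \<in> space M" for \<omega>
    using measurable_space[OF obsH_meas[OF t] that] measurable_space[OF UA_meas[rule_format, OF t] that] t
    by (auto simp: E_def space_pair_measure obsA_eq)
  have reg: "is_regression M (obsH S t) (HistM t) (\<lambda>\<omega>. indicator E (obsH S t \<omega>, UA S t \<omega>)) (pAt pA t n)"
    by (rule is_regression_cong_AE[OF prob_space_axioms _ _ _ _ regression_obsA[OF t, of n]])
      (auto simp: E indicator_def)
  have ci: "cond_indep M (obsH S t) (HistM t) (UA S t) (UAM t) (later t) (ExoM {t<..T})"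
    using seq_rand t unfolding later_def[abs_def] ExoM_def by auto
  have "(\<integral>\<^sup>+\<omega>. indicator E (obsH S t \<omega>, UA S t \<omega>) * G (obsH S t \<omega>) (later t \<omega>) \<partial>M)
    = (\<integral>\<^sup>+\<omega>. ennreal (pAt pA t n (obsH S t \<omega>)) * G (obsH S t \<omega>) (later t \<omega>) \<partial>M)"
    using cond_indep_nn_integral[OF prob_space_axioms _ _ _ ci _ reg G] by simp
  moreover have "(\<integral>\<^sup>+\<omega>. of_bool (obsA S t \<omega> = n) * G (obsH S t \<omega>) (later t \<omega>) \<partial>M)
    = (\<integral>\<^sup>+\<omega>. indicator E (obsH S t \<omega>, UA S t \<omega>) * G (obsH S t \<omega>) (later t \<omega>) \<partial>M)"
    by (intro nn_integral_cong) (auto simp: E indicator_def)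
  ultimately show ?thesis by simp
qed

text \<open>The observed treatment may be averaged by its conditional law given the history while
  the later exogenous variables stay in place. \<open>future_step_weight\<close> uses this in both
  directions.\<close>

lemma seq_rand_sum:
  assumes t: "t \<in> {1..T}"
    and G: "\<And>n. (\<lambda>(h, u). G n h u) \<in> borel_measurable (HistM t \<Otimes>\<^sub>M ExoM {t<..T})"
  shows "(\<integral>\<^sup>+\<omega>. G (obsA S t \<omega>) (obsH S t \<omega>) (later t \<omega>) \<partial>M)
    = (\<integral>\<^sup>+\<omega>. (\<Sum>n\<in>UNIV. ennreal (pAt pA t n (obsH S t \<omega>)) * G n (obsH S t \<omega>) (later t \<omega>)) \<partial>M)"
proof -
  note [measurable] = obsA_meas[OF t] obsH_meas[OF t] later_meas[of t] pAt_meas[OF t]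
  have [measurable]: "(\<lambda>\<omega>. G n (obsH S t \<omega>) (later t \<omega>)) \<in> borel_measurable M" for n
    using measurable_compose[OF measurable_Pair[OF obsH_meas[OF t] later_meas[of t]] G[of n]] by simp
  have "(\<integral>\<^sup>+\<omega>. G (obsA S t \<omega>) (obsH S t \<omega>) (later t \<omega>) \<partial>M)
      = (\<integral>\<^sup>+\<omega>. (\<Sum>n\<in>UNIV. of_bool (obsA S t \<omega> = n) * G n (obsH S t \<omega>) (later t \<omega>)) \<partial>M)"
    by (intro nn_integral_cong) (auto simp: UNIV_bool)
  also have "\<dots> = (\<Sum>n\<in>UNIV. \<integral>\<^sup>+\<omega>. of_bool (obsA S t \<omega> = n) * G n (obsH S t \<omega>) (later t \<omega>) \<partial>M)"
    by (intro nn_integral_sum) auto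
  also have "\<dots> = (\<Sum>n\<in>UNIV. \<integral>\<^sup>+\<omega>. ennreal (pAt pA t n (obsH S t \<omega>)) * G n (obsH S t \<omega>) (later t \<omega>) \<partial>M)"
    by (intro sum.cong refl seq_rand_nn_integral t G)
  also have "\<dots> = (\<integral>\<^sup>+\<omega>. (\<Sum>n\<in>UNIV. ennreal (pAt pA t n (obsH S t \<omega>)) * G n (obsH S t \<omega>) (later t \<omega>)) \<partial>M)"
    by (intro nn_integral_sum[symmetric]) auto
  finally show ?thesis .
qed

text \<open>Both sides become sums over treatment values once the observed treatment is averaged:
  sum_n P(n) sum_b flip(n, b) G(b) = sum_b Q(b) G(b) = sum_b P(b) ratio(b) G(b).\<close>

lemma future_step_weight:
  assumes k: "k + Suc j \<le> T"
    and phi: "(\<lambda>(p, y). phi p y) \<in> borel_measurable (PrevM (Suc (k + Suc j)) \<Otimes>\<^sub>M UYM)"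
  shows "(\<integral>\<^sup>+\<omega>. ennreal (weight k (obsPrev S (Suc k) \<omega>)) * future phi (Suc j) k (obsPrev S (Suc k) \<omega>) (exog \<omega>) \<partial>M)
    = (\<integral>\<^sup>+\<omega>. ennreal (weight (Suc k) (obsPrev S (Suc (Suc k)) \<omega>))
        * future phi j (Suc k) (obsPrev S (Suc (Suc k)) \<omega>) (exog \<omega>) \<partial>M)"
proof -
  let ?t = "Suc k"
  have t: "?t \<in> {1..T}" and kT: "k \<le> T" using k by auto
  let ?N = "HistM ?t \<Otimes>\<^sub>M ExoM {?t<..T}"
  define G where "G b h u = future phi j ?t (add_trt ?t h b) u" for b h u
  have G: "(\<lambda>(h, u). G b h u) \<in> borel_measurable ?N" for b
    unfolding G_def case_prod_beta using k phi
    by (intro future_measurable[where I="{?t<..T}"] measurable_add_trt) auto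
  have w: "(\<lambda>q. weight k (fst q)) \<in> borel_measurable ?N"
    using k by (intro measurable_compose[OF measurable_fst weight_meas_Hist]) auto
  have fl: "(\<lambda>q. flip_prob a f ?t (fst q) n b) \<in> borel_measurable ?N" for n b
    by (rule flip_prob_measurable[where N="HistM ?t"]) (use f_meas'[OF t] in auto)
  have ra: "(\<lambda>q. ratio ?t (fst q) b) \<in> borel_measurable ?N" for b
    by (intro measurable_compose[OF measurable_fst ratio_meas] t)
  have later_eq: "future phi j ?t p (exog \<omega>) = future phi j ?t p (later ?t \<omega>)" for p \<omega>
    using k by (intro future_cong) (auto simp: exog_def later_def)
  \<comment> \<open>\<open>L\<close> flips the natural value n, whereas \<open>R\<close> keeps it
    and multiplies by the ratio.\<close>
  define L where "L n h u = ennreal (weight k h) * (\<Sum>b\<in>UNIV. ennreal (flip_prob a f ?t h n b) * G b h u)" for n h u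
  define R where "R n h u = ennreal (weight k h * ratio ?t h n) * G n h u" for n h u
  have L: "(\<lambda>(h, u). L n h u) \<in> borel_measurable ?N" for n
    using w fl G unfolding L_def case_prod_beta by measurable
  have R: "(\<lambda>(h, u). R n h u) \<in> borel_measurable ?N" for n
    using w ra G unfolding R_def case_prod_beta by measurable
  \<comment> \<open>At the observed past the first structural step inside \<open>future\<close>
    reproduces the observed covariate and treatment, so the flip there acts on the observed
    history.\<close>
  have "ennreal (weight k (obsPrev S ?t \<omega>)) * future phi (Suc j) k (obsPrev S ?t \<omega>) (exog \<omega>)
      = L (obsA S ?t \<omega>) (obsH S ?t \<omega>) (later ?t \<omega>)" for \<omega>
  proof -
    have "fst (exog \<omega>) ?t = UX S ?t \<omega>" "fst (snd (exog \<omega>)) ?t = UA S ?t \<omega>"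
      using t by (auto simp: exog_def)
    then show ?thesis
      by (simp add: L_def G_def weight_add_cov Let_def later_eq obsA_eq obsH_Suc obsX_eq)
  qed
  then have "(\<integral>\<^sup>+\<omega>. ennreal (weight k (obsPrev S ?t \<omega>)) * future phi (Suc j) k (obsPrev S ?t \<omega>) (exog \<omega>) \<partial>M)
      = (\<integral>\<^sup>+\<omega>. L (obsA S ?t \<omega>) (obsH S ?t \<omega>) (later ?t \<omega>) \<partial>M)"
    by (simp only:)
  also have "\<dots> = (\<integral>\<^sup>+\<omega>. (\<Sum>n\<in>UNIV. ennreal (pAt pA ?t n (obsH S ?t \<omega>)) * L n (obsH S ?t \<omega>) (later ?t \<omega>)) \<partial>M)"
    by (rule seq_rand_sum[OF t L])
  also have "\<dots> = (\<integral>\<^sup>+\<omega>. (\<Sum>n\<in>UNIV. ennreal (pAt pA ?t n (obsH S ?t \<omega>)) * R n (obsH S ?t \<omega>) (later ?t \<omega>)) \<partial>M)"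
  proof (rule nn_integral_cong_AE)
    show "AE \<omega> in M. (\<Sum>n\<in>UNIV. ennreal (pAt pA ?t n (obsH S ?t \<omega>)) * L n (obsH S ?t \<omega>) (later ?t \<omega>))
        = (\<Sum>n\<in>UNIV. ennreal (pAt pA ?t n (obsH S ?t \<omega>)) * R n (obsH S ?t \<omega>) (later ?t \<omega>))"
      using AE_prob_bounds[OF t] AE_weight_nonneg[OF kT] AE_space
    proof eventually_elim
      case (elim \<omega>)
      let ?h = "obsH S ?t \<omega>" and ?u = "later ?t \<omega>"
      let ?p = "\<lambda>n. pAt pA ?t n ?h" and ?W = "weight k ?h"
      have W: "0 \<le> ?W"
        using elim k by (simp add: weight_obsH)
      have "0 \<le> f ?t ?h" "f ?t ?h \<le> 1"
        using f_range t measurable_space[OF obsH_meas[OF t] elim(3)] by auto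
      then have fl0: "0 \<le> flip_prob a f ?t ?h n b" for n b
        by (auto simp: flip_prob_def)
      have "(\<Sum>n\<in>UNIV. ennreal (?p n) * L n ?h ?u)
          = (\<Sum>n\<in>UNIV. \<Sum>b\<in>UNIV. ennreal (?p n * flip_prob a f ?t ?h n b) * (ennreal ?W * G b ?h ?u))"
        using elim fl0 unfolding L_def
        by (intro sum.cong refl) (simp add: sum_distrib_left ennreal_mult mult_ac)
      \<comment> \<open>After exchanging the sums, the one over natural values is Q; moving
        \<open>ennreal\<close> across it requires nonnegative terms.\<close>
      also have "\<dots> = (\<Sum>b\<in>UNIV. ennreal (Qf pA f a ?t b ?h) * (ennreal ?W * G b ?h ?u))"
        using elim fl0 unfolding Qf_eq_sum_flip_prob
        by (subst sum.swap, intro sum.cong refl)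
          (simp add: sum_distrib_right[symmetric])
      also have "\<dots> = (\<Sum>b\<in>UNIV. ennreal (?p b) * R b ?h ?u)"
      proof (intro sum.cong refl)
        fix b
        have "?p b * (?W * ratio ?t ?h b) = Qf pA f a ?t b ?h * ?W"
          using elim(1) by (cases "?p b = 0") (auto simp: ratio_def)
        then have "ennreal (?p b) * ennreal (?W * ratio ?t ?h b) = ennreal (Qf pA f a ?t b ?h) * ennreal ?W"
          using elim(1) W by (simp add: ratio_def flip: ennreal_mult)
        then show "ennreal (Qf pA f a ?t b ?h) * (ennreal ?W * G b ?h ?u) = ennreal (?p b) * R b ?h ?u"
          unfolding R_def by (simp add: mult.assoc[symmetric])
      qed
      finally show ?case .
    qed
  qed
  also have "\<dots> = (\<integral>\<^sup>+\<omega>. R (obsA S ?t \<omega>) (obsH S ?t \<omega>) (later ?t \<omega>) \<partial>M)"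
    by (rule seq_rand_sum[OF t R, symmetric])
  also have "\<dots> = (\<integral>\<^sup>+\<omega>. ennreal (weight (Suc k) (obsPrev S (Suc (Suc k)) \<omega>))
        * future phi j (Suc k) (obsPrev S (Suc (Suc k)) \<omega>) (exog \<omega>) \<partial>M)"
    by (simp add: R_def G_def later_eq weight_obsPrev_Suc obsPrev_Suc_Suc[symmetric])
  finally show ?thesis .
qed

lemma future_weight:
  assumes "k + j \<le> T"
    and "(\<lambda>(p, y). phi p y) \<in> borel_measurable (PrevM (Suc (k + j)) \<Otimes>\<^sub>M UYM)"
  shows "(\<integral>\<^sup>+\<omega>. ennreal (weight k (obsPrev S (Suc k) \<omega>)) * future phi j k (obsPrev S (Suc k) \<omega>) (exog \<omega>) \<partial>M)
    = (\<integral>\<^sup>+\<omega>. ennreal (weight (k + j) (obsPrev S (Suc (k + j)) \<omega>)) * phi (obsPrev S (Suc (k + j)) \<omega>) (UY S \<omega>) \<partial>M)"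
  using assms
proof (induction j arbitrary: k)
  case 0
  then show ?case by (simp add: exog_def)
next
  case (Suc j)
  then show ?case
    using Suc.IH[of "Suc k"] future_step_weight[of k j phi] by simp
qed

text \<open>At k = 0 both pasts are empty and the weight is an empty product, so the left-hand sides
  of \<open>future_flip\<close> and \<open>future_weight\<close> coincide.\<close>

lemma flip_nn_integral:
  assumes "n \<le> T"
    and "(\<lambda>(p, y). phi p y) \<in> borel_measurable (PrevM (Suc n) \<Otimes>\<^sub>M UYM)"
  shows "(\<integral>\<^sup>+\<omega>. phi (cf_past S (flip_regime a f) n \<omega>) (UY S \<omega>) \<partial>M)
    = (\<integral>\<^sup>+\<omega>. ennreal (weight n (obsPrev S (Suc n) \<omega>)) * phi (obsPrev S (Suc n) \<omega>) (UY S \<omega>) \<partial>M)"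
  using future_flip[of 0 n phi] future_weight[of 0 n phi] assms
  by (simp add: obsPrev_eq_cf_past weight_def)

text \<open>The nonnegative identity is applied to the positive and the negative part. Finiteness of
  both parts transfers, so integrability of the weighted outcome is a conclusion.\<close>

lemma flip_integral:
  fixes phi :: "'x hist \<Rightarrow> 'uy \<Rightarrow> real"
  assumes n: "n \<le> T"
    and phi: "(\<lambda>(p, y). phi p y) \<in> borel_measurable (PrevM (Suc n) \<Otimes>\<^sub>M UYM)"
    and int: "integrable M (\<lambda>\<omega>. phi (cf_past S (flip_regime a f) n \<omega>) (UY S \<omega>))"
  shows "integrable M (\<lambda>\<omega>. weight n (obsPrev S (Suc n) \<omega>) * phi (obsPrev S (Suc n) \<omega>) (UY S \<omega>))"
    and "(\<integral>\<omega>. phi (cf_past S (flip_regime a f) n \<omega>) (UY S \<omega>) \<partial>M)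
      = (\<integral>\<omega>. weight n (obsPrev S (Suc n) \<omega>) * phi (obsPrev S (Suc n) \<omega>) (UY S \<omega>) \<partial>M)"
proof -
  let ?X = "\<lambda>\<omega>. phi (cf_past S (flip_regime a f) n \<omega>) (UY S \<omega>)"
  let ?Z = "\<lambda>\<omega>. weight n (obsPrev S (Suc n) \<omega>) * phi (obsPrev S (Suc n) \<omega>) (UY S \<omega>)"
  have phiZ: "(\<lambda>\<omega>. phi (obsPrev S (Suc n) \<omega>) (UY S \<omega>)) \<in> borel_measurable M"
    using measurable_compose[OF measurable_Pair[OF obsPrev_meas[OF n] UY_meas] phi] by simp
  have m: "?Z \<in> borel_measurable M"
    using phiZ n by (intro borel_measurable_times measurable_compose[OF obsPrev_meas weight_meas_Prev]) auto
  have eq: "(\<integral>\<^sup>+\<omega>. ennreal (s * ?X \<omega>) \<partial>M) = (\<integral>\<^sup>+\<omega>. ennreal (s * ?Z \<omega>) \<partial>M)" for s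
  proof -
    have "(\<integral>\<^sup>+\<omega>. ennreal (s * ?X \<omega>) \<partial>M)
        = (\<integral>\<^sup>+\<omega>. ennreal (weight n (obsPrev S (Suc n) \<omega>)) * ennreal (s * phi (obsPrev S (Suc n) \<omega>) (UY S \<omega>)) \<partial>M)"
      using phi n by (intro flip_nn_integral) (auto simp: case_prod_beta)
    also have "\<dots> = (\<integral>\<^sup>+\<omega>. ennreal (s * ?Z \<omega>) \<partial>M)"
      using AE_weight_nonneg[OF n]
      by (intro nn_integral_cong_AE) (auto simp: ennreal_mult'[symmetric] mult_ac)
    finally show ?thesis .
  qed
  from eq[of 1] eq[of "-1"] show i: "integrable M ?Z"
    using int m by (simp add: real_integrable_def)
  from eq[of 1] eq[of "-1"] show "integral\<^sup>L M ?X = integral\<^sup>L M ?Z"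
    by (simp add: real_lebesgue_integral_def[OF int] real_lebesgue_integral_def[OF i])
qed

end

section \<open>The g-formula\<close>

locale flip_kernel_model = flip_model M S UXM UAM UYM T a f pA
  for M :: "'w measure" and S :: "('w, 'x::topological_space, 'ux, 'ua, 'uy) scm"
    and UXM UAM UYM T a f pA +
  fixes K :: "nat \<Rightarrow> 'x hist \<Rightarrow> 'x measure"
  assumes K_kernel: "\<forall>t\<in>{1..T}. K t \<in> measurable (PrevM t) (prob_algebra borel)"
    and K_cond: "\<forall>t\<in>{1..T}. \<forall>B\<in>sets borel. is_regression M (obsPrev S t) (PrevM t)
                     (\<lambda>\<omega>. indicator B (obsX S t \<omega>)) (\<lambda>h. measure (K t h) B)"
begin

text \<open>The remaining arguments are the number of integrations still to do, the time of the next
  one and the covariates fixed so far. For horizon n the inner part from time k + 1 on has arguments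
  n - k and \<open>Suc k\<close>.\<close>

definition gpart :: "('x hist \<Rightarrow> real) \<Rightarrow> (nat \<Rightarrow> bool) \<Rightarrow> nat \<Rightarrow> nat \<Rightarrow> (nat \<Rightarrow> 'x) \<Rightarrow> real" where
  "gpart mu bs = itint (\<lambda>t xs. K t (xs, restrict bs {1..<t}))
     (\<lambda>t xs. Qf pA f a t (bs t) (xs, restrict bs {1..<t})) (\<lambda>xs. mu (xs, bs))"

definition follows :: "(nat \<Rightarrow> bool) \<Rightarrow> nat \<Rightarrow> 'x hist \<Rightarrow> real" where
  "follows bs k p = of_bool (\<forall>s\<in>{1..k}. snd p s = bs s)"

lemma follows_measurable:
  assumes "{1..k} \<subseteq> J"
  shows "follows bs k \<in> borel_measurable (PiM I (\<lambda>_. borel) \<Otimes>\<^sub>M PiM J (\<lambda>_. count_space UNIV))" (is "_ \<in> borel_measurable ?N")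
proof -
  have "Measurable.pred ?N (\<lambda>p. \<forall>s\<in>{1..k}. snd p s = bs s)"
  proof (rule pred_intros_finite)
    fix s assume "s \<in> {1..k}"
    then have [measurable]: "(\<lambda>p. snd p s) \<in> measurable ?N (count_space UNIV)"
      using assms by (intro measurable_compose[OF measurable_snd measurable_component_singleton]) auto
    show "Measurable.pred ?N (\<lambda>p. snd p s = bs s)"
      by measurable
  qed simp
  then show ?thesis
    unfolding follows_def by measurable
qed

lemma follows_meas_Prev: "follows bs k \<in> borel_measurable (PrevM (Suc k))"
  unfolding PrevM_def by (rule follows_measurable) auto

lemma follows_meas_Hist: "follows bs k \<in> borel_measurable (HistM (Suc k))"
  unfolding HistM_def by (rule follows_measurable) auto

text \<open>Extensionality turns agreement at times 1 to k into equality of functions, as needed for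
  substituting the path into arguments of \<open>K\<close> and Q.\<close>

lemma follows_restrict:
  assumes "p \<in> space (PrevM (Suc k))" "follows bs k p \<noteq> 0"
  shows "snd p = restrict bs {1..<Suc k}"
  using assms by (auto simp: follows_def PrevM_def space_pair_measure space_PiM PiE_def extensional_def fun_eq_iff)

lemma measurable_Pair_restrict:
  "xs \<in> measurable N (PiM {1..<t} (\<lambda>_. borel)) \<Longrightarrow> (\<lambda>\<omega>. (xs \<omega>, restrict bs {1..<t})) \<in> measurable N (PrevM t)"
  "xs \<in> measurable N (PiM {1..t} (\<lambda>_. borel)) \<Longrightarrow> (\<lambda>\<omega>. (xs \<omega>, restrict bs {1..<t})) \<in> measurable N (HistM t)"
  by (auto simp: PrevM_def HistM_def space_PiM intro!: measurable_Pair)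

lemma gpart_measurable:
  assumes "k + j \<le> T" "bs \<in> PiE {1..k + j} (\<lambda>_. UNIV)"
    and mu: "mu \<in> borel_measurable (PrevM (Suc (k + j)))"
  shows "gpart mu bs j (Suc k) \<in> borel_measurable (PiM {1..k} (\<lambda>_. borel))"
  using assms
proof (induction j arbitrary: k)
  case 0
  have "restrict bs {1..<Suc k} = bs"
    using 0 by (auto simp: fun_eq_iff PiE_def extensional_def)
  then have "(\<lambda>xs. (xs, bs)) \<in> measurable (PiM {1..k} (\<lambda>_. borel)) (PrevM (Suc k))"
    using measurable_Pair_restrict(1)[of "\<lambda>xs. xs" "PiM {1..k} (\<lambda>_. borel)" "Suc k" bs]
    by (simp add: atLeastLessThanSuc_atLeastAtMost)
  from measurable_compose[OF this] 0 show ?case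
    by (simp add: gpart_def)
next
  case (Suc j)
  let ?t = "Suc k" and ?X = "PiM {1..k} (\<lambda>_. borel :: 'x measure)"
  have t: "?t \<in> {1..T}" using Suc.prems by auto
  have J: "gpart mu bs j (Suc ?t) \<in> borel_measurable (PiM {1..?t} (\<lambda>_. borel))"
    using Suc.prems by (intro Suc.IH) auto
  have upd: "(\<lambda>q. (fst q)(?t := snd q)) \<in> measurable (?X \<Otimes>\<^sub>M borel) (PiM {1..?t} (\<lambda>_. borel))"
    by (intro measurable_fun_upd[where J="{1..k}"]) auto
  have "K ?t \<in> measurable (PrevM ?t) (subprob_algebra borel)"
    using K_kernel t by (intro measurable_prob_algebraD) auto
  then have "(\<lambda>xs. K ?t (xs, restrict bs {1..<?t})) \<in> measurable ?X (subprob_algebra borel)"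
    by (intro measurable_compose[OF measurable_Pair_restrict(1)]) (auto simp: atLeastLessThanSuc_atLeastAtMost)
  moreover have "(\<lambda>q. Qf pA f a ?t (bs ?t) ((fst q)(?t := snd q), restrict bs {1..<?t})
      * gpart mu bs j (Suc ?t) ((fst q)(?t := snd q))) \<in> borel_measurable (?X \<Otimes>\<^sub>M borel)"
    by (intro borel_measurable_times measurable_compose[OF upd J]
        measurable_compose[OF measurable_Pair_restrict(2)[OF upd] Qf_meas[OF t]])
  ultimately show ?case
    using kernel_integral_measurable[of "\<lambda>xs. K ?t (xs, restrict bs {1..<?t})" ?X borel
      "\<lambda>q. Qf pA f a ?t (bs ?t) ((fst q)(?t := snd q), restrict bs {1..<?t})
        * gpart mu bs j (Suc ?t) ((fst q)(?t := snd q))"]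
    by (simp add: gpart_def)
qed

text \<open>From the later stage to the earlier: conditioning on the history turns the indicator of
  the treatment at k + 1 into P, which cancels the last ratio to leave Q; conditioning on the past
  then integrates the covariate at k + 1 against \<open>K\<close>. The result is one more layer of
  the iterated integral.\<close>

lemma gpart_step:
  assumes kT: "k + Suc j \<le> T" and bs: "bs \<in> PiE {1..k + Suc j} (\<lambda>_. UNIV)"
    and mu: "mu \<in> borel_measurable (PrevM (Suc (k + Suc j)))"
    and int: "integrable M (\<lambda>\<omega>. weight (Suc k) (obsPrev S (Suc (Suc k)) \<omega>)
        * follows bs (Suc k) (obsPrev S (Suc (Suc k)) \<omega>)
        * gpart mu bs j (Suc (Suc k)) (fst (obsPrev S (Suc (Suc k)) \<omega>)))"
  shows "integrable M (\<lambda>\<omega>. weight k (obsPrev S (Suc k) \<omega>) * follows bs k (obsPrev S (Suc k) \<omega>)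
        * gpart mu bs (Suc j) (Suc k) (fst (obsPrev S (Suc k) \<omega>)))"
    and "integral\<^sup>L M (\<lambda>\<omega>. weight k (obsPrev S (Suc k) \<omega>) * follows bs k (obsPrev S (Suc k) \<omega>)
        * gpart mu bs (Suc j) (Suc k) (fst (obsPrev S (Suc k) \<omega>)))
      = integral\<^sup>L M (\<lambda>\<omega>. weight (Suc k) (obsPrev S (Suc (Suc k)) \<omega>)
        * follows bs (Suc k) (obsPrev S (Suc (Suc k)) \<omega>)
        * gpart mu bs j (Suc (Suc k)) (fst (obsPrev S (Suc (Suc k)) \<omega>)))"
proof -
  let ?L = "(\<lambda>\<omega>. weight k (obsPrev S (Suc k) \<omega>) * follows bs k (obsPrev S (Suc k) \<omega>)
        * gpart mu bs (Suc j) (Suc k) (fst (obsPrev S (Suc k) \<omega>)))"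
  let ?R = "(\<lambda>\<omega>. weight (Suc k) (obsPrev S (Suc (Suc k)) \<omega>)
        * follows bs (Suc k) (obsPrev S (Suc (Suc k)) \<omega>)
        * gpart mu bs j (Suc (Suc k)) (fst (obsPrev S (Suc (Suc k)) \<omega>)))"
  let ?t = "Suc k"
  have t: "?t \<in> {1..T}" using kT by auto
  define J where "J = gpart mu bs j (Suc ?t)"
  have J: "J \<in> borel_measurable (PiM {1..?t} (\<lambda>_. borel))"
    unfolding J_def using gpart_measurable[of "Suc k" j bs mu] kT bs mu by simp
  have Jh: "(\<lambda>h. J (fst h)) \<in> borel_measurable (HistM ?t)"
    unfolding HistM_def by (intro measurable_compose[OF measurable_fst J])
  note mW = weight_meas_Hist[of k] and mF = follows_meas_Hist[of bs k]
  define g1 where "g1 h = weight k h * follows bs k h * ratio ?t h (bs ?t) * J (fst h)" for h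
  define g2 where "g2 h = weight k h * follows bs k h * Qf pA f a ?t (bs ?t) h * J (fst h)" for h
  have g1: "g1 \<in> borel_measurable (HistM ?t)"
    unfolding g1_def using kT by (intro borel_measurable_times mW mF ratio_meas t Jh) auto
  have g2: "g2 \<in> borel_measurable (HistM ?t)"
    unfolding g2_def using kT by (intro borel_measurable_times mW mF Qf_meas t Jh) auto
  have R: "?R \<omega> = g1 (obsH S ?t \<omega>) * of_bool (obsA S ?t \<omega> = bs ?t)" for \<omega>
  proof -
    have "follows bs ?t (obsPrev S (Suc ?t) \<omega>) = follows bs k (obsH S ?t \<omega>) * of_bool (obsA S ?t \<omega> = bs ?t)"
      by (auto simp: follows_def obsPrev_Suc_Suc add_trt_def atLeastAtMostSuc_conv)
    moreover have "fst (obsPrev S (Suc ?t) \<omega>) = fst (obsH S ?t \<omega>)"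
      by (simp add: obsPrev_Suc_Suc add_trt_def)
    ultimately show ?thesis
      unfolding weight_obsPrev_Suc g1_def J_def by (cases "obsA S ?t \<omega> = bs ?t") simp_all
  qed
  have mA: "(\<lambda>\<omega>. of_bool (obsA S ?t \<omega> = bs ?t) :: real) \<in> borel_measurable M"
    using obsA_meas[OF t] by measurable
  have int1: "integrable M (\<lambda>\<omega>. g1 (obsH S ?t \<omega>) * of_bool (obsA S ?t \<omega> = bs ?t))"
    using int unfolding R .
  note r1 = regression_integral[OF prob_space_axioms obsH_meas[OF t] regression_obsA[OF t] mA g1 int1]
  have ae: "AE \<omega> in M. g1 (obsH S ?t \<omega>) * pAt pA ?t (bs ?t) (obsH S ?t \<omega>) = g2 (obsH S ?t \<omega>)"
    using AE_prob_bounds[OF t]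
  proof eventually_elim
    case (elim \<omega>)
    then show ?case
      by (cases "pAt pA ?t (bs ?t) (obsH S ?t \<omega>) = 0") (auto simp: g1_def g2_def ratio_def)
  qed
  have mg2: "(\<lambda>\<omega>. g2 (obsH S ?t \<omega>)) \<in> borel_measurable M"
    by (rule measurable_compose[OF obsH_meas[OF t] g2])
  have int2: "integrable M (\<lambda>\<omega>. g2 (obsH S ?t \<omega>))"
    by (rule integrable_cong_AE_imp[OF r1(1) mg2]) (use ae in auto)
  have e2: "(\<integral>\<omega>. g2 (obsH S ?t \<omega>) \<partial>M) = integral\<^sup>L M ?R"
    unfolding R r1(2)[symmetric] using borel_measurable_integrable[OF r1(1)] mg2 ae
    by (intro integral_cong_AE) auto
  \<comment> \<open>The same function, with the history split into the past and the newest
    covariate, over which the kernel integrates.\<close>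
  define g3 where "g3 = (\<lambda>q. g2 (add_cov ?t (fst q) (snd q)))"
  have g3: "g3 \<in> borel_measurable (PrevM ?t \<Otimes>\<^sub>M borel)"
    unfolding g3_def by (intro measurable_compose[OF _ g2] measurable_add_cov) auto
  have g23: "g2 (obsH S ?t \<omega>) = g3 (obsPrev S ?t \<omega>, obsX S ?t \<omega>)" for \<omega>
    by (simp add: g3_def obsH_Suc)
  have int3: "integrable M (\<lambda>\<omega>. g3 (obsPrev S ?t \<omega>, obsX S ?t \<omega>))"
    using int2 unfolding g23 .
  have mP: "obsPrev S ?t \<in> measurable M (PrevM ?t)"
    using kT by (intro obsPrev_meas) auto
  note r3 = kernel_integral[OF prob_space_axioms mP obsX_meas[OF t] K_kernel[rule_format, OF t]
      K_cond[rule_format, OF t] g3 int3]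
  have L: "(\<integral>x. g3 (obsPrev S ?t \<omega>, x) \<partial>K ?t (obsPrev S ?t \<omega>)) = ?L \<omega>" if "\<omega> \<in> space M" for \<omega>
  proof -
    let ?p = "obsPrev S ?t \<omega>"
    have p: "?p \<in> space (PrevM ?t)"
      using measurable_space[OF mP that] .
    have "g3 (?p, x) = (weight k ?p * follows bs k ?p)
        * (Qf pA f a ?t (bs ?t) (add_cov ?t ?p x) * J ((fst ?p)(?t := x)))" for x
      by (simp add: g3_def g2_def weight_add_cov) (simp add: follows_def add_cov_def)
    then have "(\<integral>x. g3 (?p, x) \<partial>K ?t ?p) = (weight k ?p * follows bs k ?p)
        * (\<integral>x. Qf pA f a ?t (bs ?t) (add_cov ?t ?p x) * J ((fst ?p)(?t := x)) \<partial>K ?t ?p)"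
      by simp
    also have "\<dots> = ?L \<omega>"
    \<comment> \<open>Off the event both sides vanish. On it the observed treatments are those of
      \<open>bs\<close>, so the kernel and Q at the observed past are the ones occurring in
      \<open>gpart\<close>.\<close>
    proof (cases "follows bs k ?p = 0")
      case False
      then obtain xs where xs: "?p = (xs, restrict bs {1..<?t})"
        using follows_restrict[OF p] by (metis prod.collapse)
      have "(\<integral>x. Qf pA f a ?t (bs ?t) (add_cov ?t ?p x) * J ((fst ?p)(?t := x)) \<partial>K ?t ?p)
          = gpart mu bs (Suc j) ?t (fst ?p)"
        unfolding xs by (simp add: add_cov_def J_def gpart_def)
      then show ?thesis by simp
    qed simp
    finally show ?thesis .
  qed
  show "integrable M ?L"
    using r3(1) L by (simp cong: Bochner_Integration.integrable_cong)
  have "integral\<^sup>L M ?L = (\<integral>\<omega>. (\<integral>x. g3 (obsPrev S ?t \<omega>, x) \<partial>K ?t (obsPrev S ?t \<omega>)) \<partial>M)"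
    using L by (intro Bochner_Integration.integral_cong) auto
  also have "\<dots> = integral\<^sup>L M ?R"
    using r3(2) e2 by (simp add: g23)
  finally show "integral\<^sup>L M ?L = integral\<^sup>L M ?R" .
qed

text \<open>Integrability is part of the conclusion because each step takes it from the later stage
  and hands it to the earlier one.\<close>

lemma gpart_weight:
  assumes "k + j \<le> T" "bs \<in> PiE {1..k + j} (\<lambda>_. UNIV)"
    and "mu \<in> borel_measurable (PrevM (Suc (k + j)))"
    and "integrable M (\<lambda>\<omega>. weight (k + j) (obsPrev S (Suc (k + j)) \<omega>)
        * follows bs (k + j) (obsPrev S (Suc (k + j)) \<omega>) * mu (obsPrev S (Suc (k + j)) \<omega>))"
  shows "integrable M (\<lambda>\<omega>. weight k (obsPrev S (Suc k) \<omega>) * follows bs k (obsPrev S (Suc k) \<omega>)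
        * gpart mu bs j (Suc k) (fst (obsPrev S (Suc k) \<omega>)))
    \<and> (\<integral>\<omega>. weight k (obsPrev S (Suc k) \<omega>) * follows bs k (obsPrev S (Suc k) \<omega>)
        * gpart mu bs j (Suc k) (fst (obsPrev S (Suc k) \<omega>)) \<partial>M)
      = (\<integral>\<omega>. weight (k + j) (obsPrev S (Suc (k + j)) \<omega>)
        * follows bs (k + j) (obsPrev S (Suc (k + j)) \<omega>) * mu (obsPrev S (Suc (k + j)) \<omega>) \<partial>M)"
  using assms
proof (induction j arbitrary: k)
  case 0
  have "restrict bs {1..<Suc k} = bs"
    using 0 by (auto simp: fun_eq_iff PiE_def extensional_def)
  \<comment> \<open>With no integration left, \<open>gpart\<close> evaluates \<open>mu\<close> at
    the path \<open>bs\<close>, which is the observed path only on the event selected by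
    \<open>follows\<close>.\<close>
  then have e: "weight k (obsPrev S (Suc k) \<omega>) * follows bs k (obsPrev S (Suc k) \<omega>)
        * gpart mu bs 0 (Suc k) (fst (obsPrev S (Suc k) \<omega>))
      = weight (k + 0) (obsPrev S (Suc (k + 0)) \<omega>)
        * follows bs (k + 0) (obsPrev S (Suc (k + 0)) \<omega>) * mu (obsPrev S (Suc (k + 0)) \<omega>)"
    if "\<omega> \<in> space M" for \<omega>
  proof (cases "follows bs k (obsPrev S (Suc k) \<omega>) = 0")
    case False
    have "obsPrev S (Suc k) \<omega> \<in> space (PrevM (Suc k))"
      using 0 by (intro measurable_space[OF obsPrev_meas that]) auto
    from follows_restrict[OF this False] have "obsPrev S (Suc k) \<omega> = (fst (obsPrev S (Suc k) \<omega>), bs)"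
      using \<open>restrict bs {1..<Suc k} = bs\<close> by (simp only: prod_eq_iff fst_conv snd_conv simp_thms)
    then have "mu (fst (obsPrev S (Suc k) \<omega>), bs) = mu (obsPrev S (Suc k) \<omega>)"
      by (simp only:)
    then show ?thesis
      by (simp add: gpart_def)
  qed simp
  show ?case
    by (intro conjI Bochner_Integration.integral_cong[OF refl]
        Bochner_Integration.integrable_cong[THEN iffD2, OF refl _ 0(4)]) (rule e, assumption)+
next
  case (Suc j)
  have IH: "integrable M (\<lambda>\<omega>. weight (Suc k) (obsPrev S (Suc (Suc k)) \<omega>) * follows bs (Suc k) (obsPrev S (Suc (Suc k)) \<omega>)
        * gpart mu bs j (Suc (Suc k)) (fst (obsPrev S (Suc (Suc k)) \<omega>)))
    \<and> (\<integral>\<omega>. weight (Suc k) (obsPrev S (Suc (Suc k)) \<omega>) * follows bs (Suc k) (obsPrev S (Suc (Suc k)) \<omega>)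
        * gpart mu bs j (Suc (Suc k)) (fst (obsPrev S (Suc (Suc k)) \<omega>)) \<partial>M)
      = (\<integral>\<omega>. weight (Suc k + j) (obsPrev S (Suc (Suc k + j)) \<omega>)
        * follows bs (Suc k + j) (obsPrev S (Suc (Suc k + j)) \<omega>) * mu (obsPrev S (Suc (Suc k + j)) \<omega>) \<partial>M)"
    using Suc.prems by (intro Suc.IH) simp_all
  note gs = gpart_step[OF Suc.prems(1-3) conjunct1[OF IH]]
  show ?case
    using gs IH by simp
qed

text \<open>In \<open>gpart_weight\<close> with k = 0 the past is empty and deterministic, so the
  expectation there is that of a constant, the full iterated integral. Summing over paths removes
  the indicators, since exactly one path is followed. Here \<open>mu\<close> need not be a
  regression and the horizon is free, so the lemma also serves the treatment means.\<close>

lemma gformula_Y_weight: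
  assumes n: "n \<le> T" and mu: "mu \<in> borel_measurable (PrevM (Suc n))"
    and int: "integrable M (\<lambda>\<omega>. weight n (obsPrev S (Suc n) \<omega>) * mu (obsPrev S (Suc n) \<omega>))"
  shows "gformula_Y K mu pA f a n = (\<integral>\<omega>. weight n (obsPrev S (Suc n) \<omega>) * mu (obsPrev S (Suc n) \<omega>) \<partial>M)"
proof -
  let ?p = "\<lambda>\<omega>. obsPrev S (Suc n) \<omega>"
  let ?B = "PiE {1..n} (\<lambda>_. UNIV :: bool set)"
  have finB: "finite ?B"
    by (intro finite_PiE) auto
  have mF: "(\<lambda>\<omega>. follows bs n (?p \<omega>)) \<in> borel_measurable M" for bs
    by (rule measurable_compose[OF obsPrev_meas[OF n] follows_meas_Prev])
  have i: "integrable M (\<lambda>\<omega>. weight n (?p \<omega>) * follows bs n (?p \<omega>) * mu (?p \<omega>))" for bs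
  proof (rule Bochner_Integration.integrable_bound[OF int])
    have "(\<lambda>\<omega>. (weight n (?p \<omega>) * mu (?p \<omega>)) * follows bs n (?p \<omega>)) \<in> borel_measurable M"
      by (rule borel_measurable_times[OF borel_measurable_integrable[OF int] mF])
    then show "(\<lambda>\<omega>. weight n (?p \<omega>) * follows bs n (?p \<omega>) * mu (?p \<omega>)) \<in> borel_measurable M"
      by (simp add: mult_ac)
  qed (auto simp: follows_def abs_mult)
  have "gformula_Y K mu pA f a n = (\<Sum>bs\<in>?B. gpart mu bs n 1 (\<lambda>_. undefined))"
    by (simp add: gformula_Y_def gpart_def)
  also have "\<dots> = (\<Sum>bs\<in>?B. \<integral>\<omega>. weight n (?p \<omega>) * follows bs n (?p \<omega>) * mu (?p \<omega>) \<partial>M)"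
  proof (intro sum.cong refl)
    fix bs assume "bs \<in> ?B"
    then have "(\<integral>\<omega>. weight 0 (obsPrev S (Suc 0) \<omega>) * follows bs 0 (obsPrev S (Suc 0) \<omega>)
        * gpart mu bs n (Suc 0) (fst (obsPrev S (Suc 0) \<omega>)) \<partial>M)
      = (\<integral>\<omega>. weight n (?p \<omega>) * follows bs n (?p \<omega>) * mu (?p \<omega>) \<partial>M)"
      using gpart_weight[of 0 n bs mu] n mu i[of bs] by simp
    then show "gpart mu bs n 1 (\<lambda>_. undefined) = (\<integral>\<omega>. weight n (?p \<omega>) * follows bs n (?p \<omega>) * mu (?p \<omega>) \<partial>M)"
      by (simp add: weight_def follows_def obsPrev_eq_cf_past prob_space)
  qed
  also have "\<dots> = (\<integral>\<omega>. (\<Sum>bs\<in>?B. weight n (?p \<omega>) * follows bs n (?p \<omega>) * mu (?p \<omega>)) \<partial>M)"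
    by (rule Bochner_Integration.integral_sum[symmetric]) (rule i)
  also have "\<dots> = (\<integral>\<omega>. weight n (?p \<omega>) * mu (?p \<omega>) \<partial>M)"
  proof (intro Bochner_Integration.integral_cong refl)
    fix \<omega>
    have sB: "snd (?p \<omega>) \<in> ?B"
      by (auto simp: obsPrev_def)
    have "follows bs n (?p \<omega>) = (if bs = snd (?p \<omega>) then 1 else 0)" if "bs \<in> ?B" for bs
      using PiE_ext[OF that sB] by (auto simp: follows_def)
    with sB have "(\<Sum>bs\<in>?B. follows bs n (?p \<omega>)) = 1"
      using finB by simp
    then show "(\<Sum>bs\<in>?B. weight n (?p \<omega>) * follows bs n (?p \<omega>) * mu (?p \<omega>)) = weight n (?p \<omega>) * mu (?p \<omega>)"
      by (simp add: sum_distrib_right[symmetric] sum_distrib_left[symmetric])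
  qed
  finally show ?thesis .
qed

section \<open>Means of the assigned treatments and of the outcome\<close>

text \<open>The outcome is the indicator of the last treatment. In the weighted mean at horizon t
  the last ratio meets the event that A_t is 1; conditioning on the history turns their product into
  Q_t(1 | H_t), which is why the final product stops before t.\<close>

lemma flip_treatment:
  assumes t: "t \<in> {1..T}"
  shows "(\<integral>\<omega>. of_bool (cfD S (flip_regime a f) t \<omega>) \<partial>M) = gformula_D K pA f a t"
    and "gformula_D K pA f a t
      = (\<integral>\<omega>. Qf pA f a t True (obsH S t \<omega>) * (\<Prod>s\<in>{1..<t}. ratio s (obsH S s \<omega>) (obsA S s \<omega>)) \<partial>M)"
proof -
  obtain k where k: "t = Suc k" using t by (cases t) auto
  let ?phi = "\<lambda>p y. of_bool (snd p t) :: real"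
  let ?p = "\<lambda>\<omega>. obsPrev S (Suc t) \<omega>"
  have tT: "t \<le> T" "1 \<le> t" using t by auto
  have sm: "(\<lambda>p. snd p t) \<in> measurable (PrevM (Suc t)) (count_space UNIV)"
    unfolding PrevM_def using tT
    by (intro measurable_compose[OF measurable_snd measurable_component_singleton]) auto
  then have mu: "(\<lambda>p. of_bool (snd p t) :: real) \<in> borel_measurable (PrevM (Suc t))"
    by measurable
  have phi: "(\<lambda>(p, y). ?phi p y) \<in> borel_measurable (PrevM (Suc t) \<Otimes>\<^sub>M UYM)"
    unfolding case_prod_beta by (rule measurable_compose[OF measurable_fst mu])
  have "(\<lambda>\<omega>. of_bool (snd (cf_past S (flip_regime a f) t \<omega>) t) :: real) \<in> borel_measurable M"
    by (rule measurable_compose[OF cf_past_flip_meas[OF tT(1)] mu])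
  then have int: "integrable M (\<lambda>\<omega>. ?phi (cf_past S (flip_regime a f) t \<omega>) (UY S \<omega>))"
    by (intro integrable_const_bound[of _ 1]) auto
  note fl = flip_integral[OF tT(1) phi int]
  have D: "gformula_D K pA f a t = (\<integral>\<omega>. weight t (?p \<omega>) * of_bool (snd (?p \<omega>) t) \<partial>M)"
    unfolding gformula_D_eq_gformula_Y[OF tT(2)] by (rule gformula_Y_weight[OF tT(1) mu fl(1)])
  then show "(\<integral>\<omega>. of_bool (cfD S (flip_regime a f) t \<omega>) \<partial>M) = gformula_D K pA f a t"
    using fl(2) by (simp add: cfD_eq_cf_past[OF tT(2)])
  define g where "g h = weight k h * ratio t h True" for h
  have g: "g \<in> borel_measurable (HistM t)"
    unfolding g_def using tT k weight_meas_Hist[of k] by (intro borel_measurable_times ratio_meas t) auto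
  \<comment> \<open>The outcome forces treatment 1, so the last ratio may be evaluated at
    \<open>True\<close> and becomes a function of the history.\<close>
  have e: "weight t (?p \<omega>) * of_bool (snd (?p \<omega>) t) = g (obsH S t \<omega>) * of_bool (obsA S t \<omega> = True)" for \<omega>
  proof -
    have "snd (?p \<omega>) t = obsA S t \<omega>"
      using tT by (simp add: obsPrev_def)
    then show ?thesis
      unfolding k weight_obsPrev_Suc g_def by auto
  qed
  have mA: "(\<lambda>\<omega>. of_bool (obsA S t \<omega> = True) :: real) \<in> borel_measurable M"
    using obsA_meas[OF t] by measurable
  note r = regression_integral[OF prob_space_axioms obsH_meas[OF t] regression_obsA[OF t] mA g fl(1)[unfolded e]]
  have ae: "AE \<omega> in M. g (obsH S t \<omega>) * pAt pA t True (obsH S t \<omega>)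
      = Qf pA f a t True (obsH S t \<omega>) * weight k (obsH S t \<omega>)"
    using AE_prob_bounds[OF t]
  proof eventually_elim
    case (elim \<omega>)
    then show ?case
      by (cases "pAt pA t True (obsH S t \<omega>) = 0") (auto simp: g_def ratio_def)
  qed
  have "gformula_D K pA f a t = (\<integral>\<omega>. g (obsH S t \<omega>) * pAt pA t True (obsH S t \<omega>) \<partial>M)"
    unfolding D e r(2) ..
  also have "\<dots> = (\<integral>\<omega>. Qf pA f a t True (obsH S t \<omega>) * weight k (obsH S t \<omega>) \<partial>M)"
  proof (rule integral_cong_AE[OF borel_measurable_integrable[OF r(1)] _ ae])
    show "(\<lambda>\<omega>. Qf pA f a t True (obsH S t \<omega>) * weight k (obsH S t \<omega>)) \<in> borel_measurable M"
      using tT k weight_meas_Hist[of k]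
      by (intro borel_measurable_times measurable_compose[OF obsH_meas[OF t]] Qf_meas t) auto
  qed
  finally show "gformula_D K pA f a t
      = (\<integral>\<omega>. Qf pA f a t True (obsH S t \<omega>) * (\<Prod>s\<in>{1..<t}. ratio s (obsH S s \<omega>) (obsA S s \<omega>)) \<partial>M)"
    unfolding k weight_obsH weight_obsPrev atLeastLessThanSuc_atLeastAtMost .
qed

text \<open>Since the weight is a function of the observed covariates and treatments, the regression
  property replaces Y by \<open>mu\<close> under it. That also supplies the integrability which the
  g-formula lemma demands.\<close>

lemma flip_outcome:
  assumes T: "1 \<le> T"
    and fY: "(\<lambda>(h, u). fY S h u) \<in> measurable (PrevM (Suc T) \<Otimes>\<^sub>M UYM) borel"
    and mu_reg: "is_regression M (obsPrev S (Suc T)) (PrevM (Suc T)) (obsY S T) mu"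
    and Ycf_int: "integrable M (cfY S T (flip_regime a f))"
  shows "(\<integral>\<omega>. cfY S T (flip_regime a f) \<omega> \<partial>M) = gformula_Y K mu pA f a T"
    and "gformula_Y K mu pA f a T
      = (\<integral>\<omega>. obsY S T \<omega> * (\<Prod>t\<in>{1..T}. ratio t (obsH S t \<omega>) (obsA S t \<omega>)) \<partial>M)"
proof -
  let ?p = "\<lambda>\<omega>. obsPrev S (Suc T) \<omega>"
  have Y: "obsY S T \<omega> = fY S (?p \<omega>) (UY S \<omega>)" for \<omega>
    by (simp add: obsY_def cfY_eq_cf_past[OF T] obsPrev_eq_cf_past)
  have int: "integrable M (\<lambda>\<omega>. fY S (cf_past S (flip_regime a f) T \<omega>) (UY S \<omega>))"
    using Ycf_int by (simp add: cfY_eq_cf_past[OF T, abs_def])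
  note fl = flip_integral[OF order_refl fY int, folded Y]
  have mY: "obsY S T \<in> borel_measurable M"
    using measurable_compose[OF measurable_Pair[OF obsPrev_meas[OF order_refl] UY_meas] fY]
    by (simp add: Y[abs_def])
  note r = regression_integral[OF prob_space_axioms obsPrev_meas[OF order_refl] mu_reg mY
      weight_meas_Prev[OF order_refl] fl(1)]
  have mu: "mu \<in> borel_measurable (PrevM (Suc T))"
    using mu_reg by (simp add: is_regression_def)
  have G: "gformula_Y K mu pA f a T = (\<integral>\<omega>. weight T (?p \<omega>) * obsY S T \<omega> \<partial>M)"
    unfolding gformula_Y_weight[OF order_refl mu r(1)] by (rule r(2))
  then show "(\<integral>\<omega>. cfY S T (flip_regime a f) \<omega> \<partial>M) = gformula_Y K mu pA f a T"
    using fl(2) by (simp add: cfY_eq_cf_past[OF T])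
  show "gformula_Y K mu pA f a T
      = (\<integral>\<omega>. obsY S T \<omega> * (\<Prod>t\<in>{1..T}. ratio t (obsH S t \<omega>) (obsA S t \<omega>)) \<partial>M)"
    unfolding G weight_obsPrev by (simp only: mult.commute)
qed

end

theorem theorem1:
  fixes M :: "'w measure"
    and S :: "('w, real ^ 'd, 'ux, 'ua, 'uy) scm"
    and UXM :: "nat \<Rightarrow> 'ux measure" and UAM :: "nat \<Rightarrow> 'ua measure" and UYM :: "'uy measure"
    and T :: nat
    and a :: "nat \<Rightarrow> bool"
    and f :: "nat \<Rightarrow> (real ^ 'd) hist \<Rightarrow> real"
    and pA :: "nat \<Rightarrow> (real ^ 'd) hist \<Rightarrow> real"
    and K :: "nat \<Rightarrow> (real ^ 'd) hist \<Rightarrow> (real ^ 'd) measure"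
    and mu :: "(real ^ 'd) hist \<Rightarrow> real"
  assumes M: "prob_space M"
    and T: "1 \<le> T"
    \<comment> \<open>structural equation model: measurable structural functions and exogenous variables\<close>
    and fX_meas: "\<forall>t\<in>{1..T}. (\<lambda>(h, u). fX S t h u) \<in> measurable (PrevM t \<Otimes>\<^sub>M UXM t) borel"
    and fA_meas: "\<forall>t\<in>{1..T}. (\<lambda>(h, u). fA S t h u) \<in> measurable (HistM t \<Otimes>\<^sub>M UAM t) (count_space UNIV)"
    and fY_meas: "(\<lambda>(h, u). fY S h u) \<in> measurable (PrevM (Suc T) \<Otimes>\<^sub>M UYM) borel"
    and UX_meas: "\<forall>t\<in>{1..T}. UX S t \<in> measurable M (UXM t)"
    and UA_meas: "\<forall>t\<in>{1..T}. UA S t \<in> measurable M (UAM t)"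
    and UY_meas: "UY S \<in> measurable M UYM"
    \<comment> \<open>V_1..V_T iid Unif(0,1), independent of all other variables of the model\<close>
    and V_meas: "\<forall>t\<in>{1..T}. V S t \<in> borel_measurable M"
    and V_unif: "\<forall>t\<in>{1..T}. distr M borel (V S t) = uniform_measure lborel {0..1}"
    and V_indep: "prob_space.indep_vars M (\<lambda>_. borel) (V S) {1..T}"
    and V_indep_U: "distr M ((PiM {1..T} UXM \<Otimes>\<^sub>M (PiM {1..T} UAM \<Otimes>\<^sub>M UYM)) \<Otimes>\<^sub>M PiM {1..T} (\<lambda>_. borel))
            (\<lambda>\<omega>. ((restrict (\<lambda>t. UX S t \<omega>) {1..T}, restrict (\<lambda>t. UA S t \<omega>) {1..T}, UY S \<omega>),
                   restrict (\<lambda>t. V S t \<omega>) {1..T}))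
        = distr M (PiM {1..T} UXM \<Otimes>\<^sub>M (PiM {1..T} UAM \<Otimes>\<^sub>M UYM))
            (\<lambda>\<omega>. (restrict (\<lambda>t. UX S t \<omega>) {1..T}, restrict (\<lambda>t. UA S t \<omega>) {1..T}, UY S \<omega>))
          \<Otimes>\<^sub>M distr M (PiM {1..T} (\<lambda>_. borel)) (\<lambda>\<omega>. restrict (\<lambda>t. V S t \<omega>) {1..T})"
    \<comment> \<open>strong sequential randomization\<close>
    and seq_rand: "\<forall>t\<in>{1..T}. cond_indep M (obsH S t) (HistM t)
          (UA S t) (UAM t)
          (\<lambda>\<omega>. (restrict (\<lambda>s. UX S s \<omega>) {t<..T}, restrict (\<lambda>s. UA S s \<omega>) {t<..T}, UY S \<omega>))
          (PiM {t<..T} UXM \<Otimes>\<^sub>M (PiM {t<..T} UAM \<Otimes>\<^sub>M UYM))"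
    \<comment> \<open>weight functions f_t : histories \<rightarrow> [0,1]\<close>
    and f_meas: "\<forall>t\<in>{1..T}. f t \<in> borel_measurable (HistM t)"
    and f_range: "\<forall>t\<in>{1..T}. \<forall>h\<in>space (HistM t). 0 \<le> f t h \<and> f t h \<le> 1"
    \<comment> \<open>pA t is a version of h \<mapsto> P(A_t = 1 | H_t = h)\<close>
    and pA_reg: "\<forall>t\<in>{1..T}. is_regression M (obsH S t) (HistM t) (\<lambda>\<omega>. of_bool (obsA S t \<omega>)) (pA t)"
    \<comment> \<open>K t is a regular conditional distribution of X_t given (Xbar_{t-1}, Abar_{t-1})\<close>
    and K_kernel: "\<forall>t\<in>{1..T}. K t \<in> measurable (PrevM t) (prob_algebra borel)"
    and K_cond: "\<forall>t\<in>{1..T}. \<forall>B\<in>sets borel. is_regression M (obsPrev S t) (PrevM t)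
                     (\<lambda>\<omega>. indicator B (obsX S t \<omega>)) (\<lambda>h. measure (K t h) B)"
    \<comment> \<open>mu is a version of E(Y | Abar_T = bbar_T, Xbar_T = xbar_T)\<close>
    and mu_reg: "is_regression M (obsPrev S (Suc T)) (PrevM (Suc T)) (obsY S T) mu"
    \<comment> \<open>positivity-type condition (1) or (2) for each t\<close>
    and positivity: "\<forall>t\<in>{1..T}.
          measure M {\<omega>\<in>space M. pAt pA t (a t) (obsH S t \<omega>) = 0 \<longrightarrow> f t (obsH S t \<omega>) = 0} = 1
        \<or> measure M {\<omega>\<in>space M. pAt pA t (a t) (obsH S t \<omega>) = 0} = 0"
    \<comment> \<open>the expectations involved exist\<close>
    and Y_int: "integrable M (obsY S T)"
    and Ycf_int: "integrable M (cfY S T (flip_regime a f))"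
  shows "(\<integral>\<omega>. cfY S T (flip_regime a f) \<omega> \<partial>M) = gformula_Y K mu pA f a T
       \<and> gformula_Y K mu pA f a T
           = (\<integral>\<omega>. obsY S T \<omega> * (\<Prod>t\<in>{1..T}.
                   Qf pA f a t (obsA S t \<omega>) (obsH S t \<omega>) / pAt pA t (obsA S t \<omega>) (obsH S t \<omega>)) \<partial>M)
       \<and> (\<forall>t\<in>{1..T}.
           (\<integral>\<omega>. of_bool (cfD S (flip_regime a f) t \<omega>) \<partial>M) = gformula_D K pA f a t
         \<and> gformula_D K pA f a t
           = (\<integral>\<omega>. Qf pA f a t True (obsH S t \<omega>) * (\<Prod>s\<in>{1..<t}.
                   Qf pA f a s (obsA S s \<omega>) (obsH S s \<omega>) / pAt pA s (obsA S s \<omega>) (obsH S s \<omega>)) \<partial>M))"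
proof -
  interpret flip_kernel_model M S UXM UAM UYM T a f pA K
    by (intro flip_kernel_model.intro flip_model.intro flip_model_axioms.intro
        flip_kernel_model_axioms.intro) fact+
  show ?thesis
    using flip_outcome[OF T fY_meas mu_reg Ycf_int] flip_treatment
    unfolding ratio_def by simp
qed

end
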